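(* Let $m \ge 1$ be an integer. (a) If $m$ is odd, then the number of primitive elements of length $m$ in the group $F_2$ (and therefore in any group $F_n$, $n \ge 2$) is more than $\frac{8}{3\sqrt{3}} \cdot (\sqrt{3})^m$. (b) If $m$ is even, then the number of primitive elements of length $m$ in the group $F_2$ (and therefore in any group $F_n$, $n \ge 2$) is more than $\frac{4}{3} \cdot (\sqrt{3})^m$. (c) The number of cyclically reduced primitive elements of length $m$ in the group $F_2$ is exactly $4m \cdot \Phi(m)$, where $\Phi$ is the Euler function.
   Context: $F_n$ is the free group of rank $n$ with a fixed free basis; length means reduced word length with respect to this basis. An element of $F_n$ is primitive if it belongs to some free basis of $F_n$. A reduced word is cyclically reduced if its first letter is not the inverse of its last letter. $\Phi(m)$ is the Euler totient function: the number of integers $j$ with $1 \le j \le m$ and $\gcd(j,m)=1$ (so $\Phi(1)=1$). *)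

theory Defs
  imports Complex_Main "HOL-Algebra.Generated_Groups" "HOL-Number_Theory.Totient"
begin

text \<open>
  A word over \<open>X\<close> is a list of letters: \<open>(x, False)\<close> stands for \<open>x\<close> and \<open>(x, True)\<close> for its
  formal inverse.  The elements of the free group on \<open>X\<close> are the reduced words, so the length of
  an element is the length of the list.
\<close>

type_synonym 'a word = "('a \<times> bool) list"

definition inv_letter :: "'a \<times> bool \<Rightarrow> 'a \<times> bool" where
  "inv_letter l = (fst l, \<not> snd l)"

definition reduced :: "'a word \<Rightarrow> bool" where
  "reduced w \<longleftrightarrow> successively (\<lambda>l l'. l' \<noteq> inv_letter l) w"

definition reduced_words :: "'a set \<Rightarrow> 'a word set" where
  "reduced_words X = {w. fst ` set w \<subseteq> X \<and> reduced w}"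

fun push :: "'a \<times> bool \<Rightarrow> 'a word \<Rightarrow> 'a word" where
  "push l [] = [l]"
| "push l (l' # w) = (if l' = inv_letter l then w else l # l' # w)"

definition reduce :: "'a word \<Rightarrow> 'a word" where
  "reduce w = foldr push w []"

definition free_group :: "'a set \<Rightarrow> 'a word monoid" where
  "free_group X =
     \<lparr>carrier = reduced_words X, monoid.mult = (\<lambda>u v. reduce (u @ v)), one = []\<rparr>"

definition F :: "nat \<Rightarrow> nat word monoid" where
  "F n = free_group {..<n}"

definition eval_word :: "('g, 'b) monoid_scheme \<Rightarrow> 'g word \<Rightarrow> 'g" where
  "eval_word G w =
     foldr (\<lambda>(g, b) h. (if b then inv\<^bsub>G\<^esub> g else g) \<otimes>\<^bsub>G\<^esub> h) w \<one>\<^bsub>G\<^esub>"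

text \<open>\<open>B\<close> freely generates \<open>G\<close>: it generates, and no nonempty reduced word in \<open>B\<close> is a relation.\<close>

definition free_basis :: "('g, 'b) monoid_scheme \<Rightarrow> 'g set \<Rightarrow> bool" where
  "free_basis G B \<longleftrightarrow>
     B \<subseteq> carrier G \<and> generate G B = carrier G \<and>
     (\<forall>w \<in> reduced_words B. w \<noteq> [] \<longrightarrow> eval_word G w \<noteq> \<one>\<^bsub>G\<^esub>)"

definition primitive :: "('g, 'b) monoid_scheme \<Rightarrow> 'g \<Rightarrow> bool" where
  "primitive G g \<longleftrightarrow> (\<exists>B. free_basis G B \<and> g \<in> B)"

definition cyclically_reduced :: "'a word \<Rightarrow> bool" where
  "cyclically_reduced w \<longleftrightarrow>
     reduced w \<and> (w \<noteq> [] \<longrightarrow> hd w \<noteq> inv_letter (last w))"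

lemma inv_letter_inv_letter [simp]: "inv_letter (inv_letter l) = l"
  by (simp add: inv_letter_def)

lemma fst_inv_letter [simp]: "fst (inv_letter l) = fst l"
  by (simp add: inv_letter_def)

lemma reduced_words_Nil [simp]: "[] \<in> reduced_words X"
  by (simp add: reduced_words_def reduced_def)

lemma reduced_words_Cons:
  "l # w \<in> reduced_words X \<longleftrightarrow>
     fst l \<in> X \<and> w \<in> reduced_words X \<and> (w = [] \<or> hd w \<noteq> inv_letter l)"
  by (auto simp: reduced_words_def reduced_def successively_Cons)

lemma push_Cons_reduced: "l # w \<in> reduced_words X \<Longrightarrow> push l w = l # w"
  by (cases w) (auto simp: reduced_words_Cons)

lemma push_in: "fst l \<in> X \<Longrightarrow> w \<in> reduced_words X \<Longrightarrow> push l w \<in> reduced_words X"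
  by (cases w) (auto simp: reduced_words_Cons)

lemma push_inv: "w \<in> reduced_words X \<Longrightarrow> push (inv_letter l) (push l w) = w"
  by (cases w) (auto simp: reduced_words_Cons split: list.splits elim: push.elims intro: push_Cons_reduced)

lemma foldr_push_in:
  "fst ` set u \<subseteq> X \<Longrightarrow> w \<in> reduced_words X \<Longrightarrow> foldr push u w \<in> reduced_words X"
  by (induction u) (auto intro: push_in)

lemma foldr_push_push:
  assumes "fst l \<in> X" "fst ` set u \<subseteq> X" "w \<in> reduced_words X"
  shows "foldr push (push l u) w = push l (foldr push u w)"
proof (cases u)
  case (Cons l' u')
  have "push l (push (inv_letter l) (foldr push u' w)) = foldr push u' w"
    using push_inv[of "foldr push u' w" X "inv_letter l"] foldr_push_in[of u' X w] assms Cons by auto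
  then show ?thesis using Cons by auto
qed auto

lemma reduce_id: "w \<in> reduced_words X \<Longrightarrow> reduce w = w"
  unfolding reduce_def
  by (induction w) (auto simp: push_Cons_reduced, auto simp: reduced_words_Cons push_Cons_reduced)

lemma reduce_append: "v \<in> reduced_words X \<Longrightarrow> reduce (u @ v) = foldr push u v"
  using reduce_id[of v X] by (simp add: reduce_def)

lemma foldr_push_foldr_push:
  assumes "fst ` set u \<subseteq> X" "v \<in> reduced_words X" "w \<in> reduced_words X"
  shows "foldr push (foldr push u v) w = foldr push u (foldr push v w)"
  using assms(1)
proof (induction u)
  case (Cons l u)
  have "foldr push u v \<in> reduced_words X" using Cons assms by (auto intro: foldr_push_in)
  then show ?case
    using Cons assms foldr_push_push[of l X "foldr push u v" w] by (auto simp: reduced_words_def)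
qed auto

lemma group_free_group: "group (free_group X)"
proof (rule groupI)
  fix u assume "u \<in> carrier (free_group X)"
  then have u: "u \<in> reduced_words X" by (simp add: free_group_def)
  define u' where "u' = rev (map inv_letter u)"
  define v where "v = foldr push u' []"
  have u': "fst ` set u' \<subseteq> X"
    using u by (auto simp: u'_def reduced_words_def)
  have v: "v \<in> reduced_words X"
    unfolding v_def by (rule foldr_push_in[OF u']) simp
  have "foldr push u' u = []"
    using u unfolding u'_def by (induction u) (auto simp: reduced_words_Cons)
  then have "reduce (v @ u) = []"
    using foldr_push_foldr_push[OF u' _ u, of "[]"] by (simp add: reduce_append[OF u] v_def)
  with v show "\<exists>v \<in> carrier (free_group X). v \<otimes>\<^bsub>free_group X\<^esub> u = \<one>\<^bsub>free_group X\<^esub>"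
    by (auto simp: free_group_def)
next
  fix u v assume "u \<in> carrier (free_group X)" "v \<in> carrier (free_group X)"
  then show "u \<otimes>\<^bsub>free_group X\<^esub> v \<in> carrier (free_group X)"
    using foldr_push_in[of u X v] by (simp add: free_group_def reduce_append[of _ X] reduced_words_def[of X])
next
  fix u v w assume "u \<in> carrier (free_group X)" "v \<in> carrier (free_group X)" "w \<in> carrier (free_group X)"
  then have *: "fst ` set u \<subseteq> X" "u \<in> reduced_words X" "v \<in> reduced_words X" "w \<in> reduced_words X"
    "fst ` set v \<subseteq> X"
    by (auto simp: free_group_def reduced_words_def)
  then show "(u \<otimes>\<^bsub>free_group X\<^esub> v) \<otimes>\<^bsub>free_group X\<^esub> w = u \<otimes>\<^bsub>free_group X\<^esub> (v \<otimes>\<^bsub>free_group X\<^esub> w)"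
    using foldr_push_foldr_push[of u X v w] foldr_push_in[of v X w]
    by (simp add: free_group_def reduce_append[of _ X])
qed (auto simp: free_group_def reduce_id)

lemma free_basis_standard: "free_basis (free_group X) ((\<lambda>x. [(x, False)]) ` X)"
proof -
  interpret group "free_group X" by (rule group_free_group)
  let ?G = "free_group X" and ?e = "\<lambda>x. [(x, False)]"
  have mult: "[l] \<otimes>\<^bsub>?G\<^esub> w = push l w" if "w \<in> reduced_words X" for l w
    using that reduce_append[of w X "[l]"] by (simp add: free_group_def)
  have letter: "[l] \<in> carrier ?G" if "fst l \<in> X" for l
    using that by (simp add: free_group_def reduced_words_Cons)
  have inv: "inv\<^bsub>?G\<^esub> (?e x) = [(x, True)]" if "x \<in> X" for x
  proof (rule inv_equality)
    show "[(x, True)] \<otimes>\<^bsub>?G\<^esub> ?e x = \<one>\<^bsub>?G\<^esub>"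
      using that letter[of "(x, False)"] mult[of "?e x" "(x, True)"]
      by (simp add: inv_letter_def) (simp add: free_group_def inv_letter_def)
  qed (use that in \<open>auto intro: letter\<close>)
  have sub: "?e ` X \<subseteq> carrier ?G" by (auto intro: letter)
  have "w \<in> generate ?G (?e ` X)" if "w \<in> reduced_words X" for w
    using that
  proof (induction w)
    case Nil
    then show ?case using generate.one[of ?G] by (simp add: free_group_def)
  next
    case (Cons l w)
    then have w: "w \<in> reduced_words X" and l: "fst l \<in> X" by (auto simp: reduced_words_Cons)
    have "[l] \<in> generate ?G (?e ` X)"
    proof (cases l)
      case (Pair x b)
      show ?thesis
      proof (cases b)
        case True
        then show ?thesis using Pair l inv[of x] generate.inv[of "?e x" "?e ` X" ?G] by simp
      next
        case False
        then show ?thesis using Pair l by (auto intro: generate.incl)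
      qed
    qed
    then have "[l] \<otimes>\<^bsub>?G\<^esub> w \<in> generate ?G (?e ` X)"
      using Cons.IH[OF w] by (rule generate.eng)
    then show ?case using mult[OF w, of l] push_Cons_reduced[OF Cons.prems] by simp
  qed
  then have gen: "generate ?G (?e ` X) = carrier ?G"
    using generate_incl[OF sub] by (auto simp: free_group_def)
  have "map (\<lambda>(g, b). (fst (hd g), b)) w \<in> reduced_words X \<and>
      eval_word ?G w = map (\<lambda>(g, b). (fst (hd g), b)) w" if "w \<in> reduced_words (?e ` X)" for w
    using that
  proof (induction w)
    case Nil
    then show ?case by (simp add: eval_word_def free_group_def)
  next
    case (Cons l w)
    let ?f = "\<lambda>(g :: ('a \<times> bool) list, b :: bool). (fst (hd g), b)"
    obtain x b where l: "l = (?e x, b)" and x: "x \<in> X"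
      using Cons.prems by (cases l) (auto simp: reduced_words_Cons)
    have w: "w \<in> reduced_words (?e ` X)" using Cons.prems by (simp add: reduced_words_Cons)
    note IH = Cons.IH[OF w]
    have red: "map ?f (l # w) \<in> reduced_words X"
    proof (cases w)
      case (Cons l' w')
      obtain y c where "l' = (?e y, c)" using w Cons by (cases l') (auto simp: reduced_words_Cons)
      then show ?thesis using IH Cons.prems l x Cons by (auto simp: reduced_words_Cons inv_letter_def)
    qed (use l x in \<open>simp add: reduced_words_Cons\<close>)
    have "eval_word ?G (l # w) = [(x, b)] \<otimes>\<^bsub>?G\<^esub> eval_word ?G w"
      using inv[OF x] by (simp add: eval_word_def l)
    also have "\<dots> = push (x, b) (map ?f w)" using IH mult by simp
    also have "\<dots> = map ?f (l # w)" using push_Cons_reduced[OF red[simplified]] l by simp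
    finally show ?case using red by simp
  qed
  then show ?thesis
    using sub gen by (auto simp: free_basis_def free_group_def)
qed

end

theory Submission
  imports Defs
begin

text \<open>
  The exact count rests on two facts about the free group \<open>F\<^sub>2\<close> on \<open>x\<close> and \<open>y\<close>. A primitive
  element has coprime exponent sums \<open>(a, b)\<close>, and every coprime pair belongs to exactly one
  conjugacy class of primitive elements. A cyclically reduced primitive word never uses both a
  generator and its inverse, so its length is \<open>\<bar>a\<bar> + \<bar>b\<bar>\<close>. The cyclically reduced words in one
  conjugacy class are the rotations of one of them; if there are \<open>m\<close> letters and \<open>(a, b)\<close> is
  coprime then the \<open>m\<close> rotations differ, because a word that equals a proper rotation of itself is
  a proper power. Thus the count is \<open>m\<close> times the number of coprime pairs with
  \<open>\<bar>a\<bar> + \<bar>b\<bar> = m\<close>. A quarter turn permutes the four half-open quadrants, and the quadrant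
  \<open>a > 0, b \<ge> 0\<close> contains the pairs \<open>(k, m - k)\<close> with \<open>k\<close> coprime to \<open>m\<close>; this gives
  \<open>4 m \<Phi>(m)\<close>.

  The constancy of signs is where bases enter. A basis has at most two elements, because dual
  homomorphisms to the integers would otherwise express an identity matrix of size three through
  the two exponent sums (\<open>free_basis_card_le_2\<close>). Nielsen reduction carries every generating
  pair to \<open>(x, y)\<close> by swaps, inversions, multiplications and simultaneous conjugations
  (\<open>generating_pair_nielsen\<close>). Going back, these moves preserve the property of being, up to
  swap, inversion and simultaneous conjugation, a Christoffel pair: one that is built from
  \<open>(x\<^sup>\<plusminus>\<^sup>1, y\<^sup>\<plusminus>\<^sup>1)\<close> by the two positive rules \<open>(U, V) \<mapsto> (U V, V)\<close> and
  \<open>(U, V) \<mapsto> (U, U V)\<close> (\<open>nielsen_imp_christoffel_type\<close>). The words of a Christoffel pair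
  contain each generator with one sign only.

  For the conjugacy class of a pair \<open>(a, b)\<close>, the Euclidean algorithm provides an automorphism
  \<open>\<phi>\<close> such that \<open>\<phi> x\<close> has exponent sums \<open>(a, b)\<close>. If \<open>w\<close> is any primitive element with these
  exponent sums, then \<open>\<phi>\<^sup>-\<^sup>1 w\<close> has exponent sums \<open>(1, 0)\<close>, its cyclically reduced form has
  length one and is therefore \<open>x\<close>, and \<open>w\<close> is conjugate to \<open>\<phi> x\<close>.

  The lower bounds only need conjugates of short primitive words. A cyclically reduced word can be
  conjugated without cancellation by two of the four letters \<open>x\<^sup>\<plusminus>\<^sup>1, y\<^sup>\<plusminus>\<^sup>1\<close>, and each
  result by three of them. The four letters thus yield \<open>8 \<cdot> 3\<^sup>j\<close> primitive words of length
  \<open>2 j + 3\<close>, which is exactly the bound for odd lengths; the word \<open>y x\<^sup>m\<^sup>-\<^sup>1\<close> makes it strict.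
  The eight words of length two with one occurrence each of \<open>x\<^sup>\<plusminus>\<^sup>1\<close> and \<open>y\<^sup>\<plusminus>\<^sup>1\<close> yield
  \<open>16 \<cdot> 3\<^sup>j\<close> words of length \<open>2 j + 4\<close>.
\<close>

section \<open>Reduced words\<close>

definition winv :: "'a word \<Rightarrow> 'a word" where
  "winv w = rev (map inv_letter w)"

lemma winv_Nil [simp]: "winv [] = []"
  by (simp add: winv_def)

lemma winv_Cons [simp]: "winv (l # w) = winv w @ [inv_letter l]"
  by (simp add: winv_def)

lemma winv_append [simp]: "winv (u @ v) = winv v @ winv u"
  by (simp add: winv_def)

lemma winv_winv [simp]: "winv (winv w) = w"
  by (induction w) auto

lemma length_winv [simp]: "length (winv w) = length w"
  by (simp add: winv_def)

lemma winv_eq_Nil_iff [simp]: "winv w = [] \<longleftrightarrow> w = []"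
  by (simp add: winv_def)

lemma hd_winv: "w \<noteq> [] \<Longrightarrow> hd (winv w) = inv_letter (last w)"
  by (cases w rule: rev_cases) auto

lemma fst_set_winv [simp]: "fst ` set (winv w) = fst ` set w"
  by (induction w) auto

lemma inv_letter_neq [simp]: "inv_letter l \<noteq> l" "l \<noteq> inv_letter l"
  by (cases l; simp add: inv_letter_def)+

lemma inv_letter_eq_iff [simp]: "inv_letter l = inv_letter l' \<longleftrightarrow> l = l'"
  by (metis inv_letter_inv_letter)

lemma inv_letter_Pair [simp]: "inv_letter (x, b) = (x, \<not> b)"
  by (simp add: inv_letter_def)

lemma reduced_Nil [simp]: "reduced []"
  by (simp add: reduced_def)

lemma reduced_Cons: "reduced (l # w) \<longleftrightarrow> reduced w \<and> (w = [] \<or> hd w \<noteq> inv_letter l)"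
  by (auto simp: reduced_def successively_Cons)

lemma reduced_append:
  "reduced (u @ v) \<longleftrightarrow>
     reduced u \<and> reduced v \<and> (u = [] \<or> v = [] \<or> hd v \<noteq> inv_letter (last u))"
  by (auto simp: reduced_def successively_append_iff)

lemma reduced_winv [simp]: "reduced (winv w) \<longleftrightarrow> reduced w"
proof (induction w)
  case (Cons l w)
  then show ?case
    by (cases w) (auto simp: reduced_append reduced_Cons)
qed simp

lemma reduced_words_UNIV: "w \<in> reduced_words UNIV \<longleftrightarrow> reduced w"
  by (simp add: reduced_words_def)

lemma reduced_reduce: "reduced (reduce w)"
  using foldr_push_in[of w UNIV "[]"] by (simp add: reduce_def reduced_words_UNIV)

lemma reduce_reduced: "reduced w \<Longrightarrow> reduce w = w"
  using reduce_id[of w UNIV] by (simp add: reduced_words_UNIV)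

lemma reduce_append_foldr: "reduce (u @ v) = foldr push u (reduce v)"
  by (simp add: reduce_def)

lemma reduce_reduce_right [simp]: "reduce (u @ reduce v) = reduce (u @ v)"
  by (simp add: reduce_append_foldr reduce_reduced reduced_reduce)

lemma reduce_reduce_left [simp]: "reduce (reduce u @ v) = reduce (u @ v)"
  using foldr_push_foldr_push[of u UNIV "[]" "reduce v"] reduced_reduce[of v]
  by (simp add: reduce_append_foldr reduced_words_UNIV) (simp add: reduce_def)

lemma reduce_reduce_inner: "reduce (a @ reduce b @ c) = reduce (a @ b @ c)"
  by (metis reduce_reduce_left reduce_reduce_right)

lemma push_inv_letter: "reduced w \<Longrightarrow> push l (push (inv_letter l) w) = w"
  using push_inv[of w UNIV "inv_letter l"] by (simp add: reduced_words_UNIV)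

lemma foldr_push_winv: "reduced w \<Longrightarrow> foldr push s (foldr push (winv s) w) = w"
proof (induction s arbitrary: w)
  case (Cons l s)
  have "reduced (push (inv_letter l) w)"
    using Cons.prems push_in[of "inv_letter l" UNIV w] by (simp add: reduced_words_UNIV)
  with Cons show ?case by (simp add: push_inv_letter)
qed simp

lemma reduce_cancel: "reduce (a @ s @ winv s @ b) = reduce (a @ b)"
  by (simp add: reduce_append_foldr foldr_push_winv reduced_reduce)

lemma reduce_cancel_winv: "reduce (a @ winv s @ s @ b) = reduce (a @ b)"
  using reduce_cancel[of a "winv s" b] by simp

lemma reduce_winv [simp]: "reduce (winv w @ w) = []" "reduce (w @ winv w) = []"
  using reduce_cancel_winv[of "[]" w "[]"] reduce_cancel[of "[]" w "[]"] by (simp_all add: reduce_def)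

lemma length_reduce_le: "length (reduce w) \<le> length w"
proof (induction w)
  case (Cons l w)
  have "length (push l v) \<le> Suc (length v)" for v by (cases v) auto
  from this[of "reduce w"] Cons show ?case by (simp add: reduce_def)
qed (simp add: reduce_def)

text \<open>
  The cancellation in a product of two reduced words is confined to one middle piece \<open>s\<close>: strip
  letters from the end of \<open>u\<close> as long as they cancel.
\<close>

lemma reduced_product_cases:
  assumes "reduced u" "reduced v"
  obtains p s q where "u = p @ s" "v = winv s @ q" "reduced (p @ q)" "reduce (u @ v) = p @ q"
proof -
  have "\<exists>p s q. u = p @ s \<and> v = winv s @ q \<and> reduced (p @ q) \<and> reduce (u @ v) = p @ q"
    using assms
  proof (induction u arbitrary: v rule: rev_induct)
    case Nil
    then show ?case
      by (intro exI[of _ "[]"] exI[of _ v]) (simp add: reduce_reduced)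
  next
    case (snoc t u)
    show ?case
    proof (cases "v \<noteq> [] \<and> hd v = inv_letter t")
      case True
      then obtain v' where v: "v = inv_letter t # v'" by (cases v) auto
      have "reduced u" "reduced v'"
        using snoc.prems v by (auto simp: reduced_append reduced_Cons)
      from snoc.IH[OF this] obtain p s q where
        "u = p @ s" "v' = winv s @ q" "reduced (p @ q)" "reduce (u @ v') = p @ q" by blast
      moreover have "reduce ((u @ [t]) @ v) = reduce (u @ v')"
        using reduce_cancel[of u "[t]" v'] v by simp
      ultimately show ?thesis using v
        by (intro exI[of _ p] exI[of _ "s @ [t]"] exI[of _ q]) simp
    next
      case False
      with snoc.prems have "reduced ((u @ [t]) @ v)"
        by (subst reduced_append) auto
      then show ?thesis
        by (intro exI[of _ "u @ [t]"] exI[of _ "[]"] exI[of _ v]) (simp add: reduce_reduced)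
    qed
  qed
  then show ?thesis using that by blast
qed

lemma even_length_product:
  assumes "reduced u" "reduced v"
  shows "even (length (reduce (u @ v)) + length u + length v)"
  using assms by (elim reduced_product_cases[of u v]) auto

text \<open>
  The hypothesis says that the parts of \<open>y\<close> cancelled by \<open>x\<close> and by \<open>z\<close> have together fewer
  letters than \<open>y\<close>. So a nonempty piece \<open>m\<close> of \<open>y\<close> survives and keeps the two cancellations
  apart.
\<close>

lemma length_triple_product:
  assumes "reduced x" "reduced y" "reduced z"
    and "length x + length z < length (reduce (x @ y)) + length (reduce (y @ z))"
  shows "length (reduce (x @ y @ z)) + length y = length (reduce (x @ y)) + length (reduce (y @ z))"
proof -
  obtain p s q where 1: "x = p @ s" "y = winv s @ q" "reduced (p @ q)" "reduce (x @ y) = p @ q"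
    using reduced_product_cases[OF assms(1,2)] by blast
  obtain p' s' q' where 2: "y = p' @ s'" "z = winv s' @ q'" "reduced (p' @ q')" "reduce (y @ z) = p' @ q'"
    using reduced_product_cases[OF assms(2,3)] by blast
  have len: "length s + length q = length p' + length s'"
    using 1 2 by (metis length_append length_winv)
  have less: "length s + length s' < length y"
    using assms(4) len unfolding 1(4) 2(4) by (simp add: 1(1) 2(1,2))
  define m where "m = drop (length s) p'"
  have "length s < length p'" using less 2(1) by simp
  then have m: "m \<noteq> []" and "p' = winv s @ m"
    using 1(2) 2(1) by (auto simp: m_def append_eq_append_conv_if)
      (metis append_take_drop_id length_winv)
  then have q: "q = m @ s'" and p': "p' = winv s @ m" using 1(2) 2(1) by auto
  have "reduced (p @ m)" "reduced (m @ q')"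
    using 1(3) 2(3) q p' by (auto simp: reduced_append)
  then have "reduced (p @ m @ q')" using m by (auto simp: reduced_append)
  moreover have "reduce (x @ y @ z) = reduce (p @ m @ q')"
    using reduce_cancel[of p s "q @ z"] reduce_cancel[of "p @ m" s' q'] 1 2 q by simp
  ultimately have "reduce (x @ y @ z) = p @ m @ q'" by (simp add: reduce_reduced)
  then show ?thesis using 1 2 q p' by simp
qed

section \<open>Conjugation and cyclic words\<close>

lemma cyclically_reduced_iff:
  "cyclically_reduced w \<longleftrightarrow> reduced (w @ w)"
  by (auto simp: cyclically_reduced_def reduced_append)

lemma cyclically_reduced_swap:
  "cyclically_reduced (a @ b) \<Longrightarrow> cyclically_reduced (b @ a)"
  by (cases "a = []"; cases "b = []") (auto simp: cyclically_reduced_iff reduced_append)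

lemma cyclically_reduced_rotate: "cyclically_reduced w \<Longrightarrow> cyclically_reduced (rotate k w)"
  unfolding rotate_drop_take by (rule cyclically_reduced_swap) simp

text \<open>
  As long as the first and the last letter of \<open>w\<close> are inverse to each other, move them into \<open>g\<close>.
\<close>

lemma cyclic_reduction:
  assumes "reduced w"
  obtains g c where "w = g @ c @ winv g" "cyclically_reduced c" "c = [] \<longleftrightarrow> w = []"
proof -
  have "\<exists>g c. w = g @ c @ winv g \<and> cyclically_reduced c \<and> (c = [] \<longleftrightarrow> w = [])"
    using assms
  proof (induction "length w" arbitrary: w rule: less_induct)
    case less
    show ?case
    proof (cases "cyclically_reduced w")
      case True
      then show ?thesis by (intro exI[of _ "[]"] exI[of _ w]) simp
    next
      case False
      then have w: "w \<noteq> []" "hd w = inv_letter (last w)"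
        using less.prems by (auto simp: cyclically_reduced_def)
      have "tl w \<noteq> []" using w by (cases w) auto
      then obtain t v where v: "w = t # v @ [inv_letter t]"
        using w by (cases w; cases "tl w" rule: rev_cases) auto
      have "v \<noteq> []" "reduced v" using less.prems v by (auto simp: reduced_Cons reduced_append)
      then obtain g c where "v = g @ c @ winv g" "cyclically_reduced c" "c \<noteq> []"
        using less.hyps[of v] v by auto
      then show ?thesis using v by (intro exI[of _ "t # g"] exI[of _ c]) simp
    qed
  qed
  then show ?thesis using that by blast
qed

text \<open>
  If \<open>w = g c g\<^sup>-\<^sup>1\<close> with \<open>c\<close> cyclically reduced, then \<open>w\<^sup>2 = g c c g\<^sup>-\<^sup>1\<close> as it stands.
\<close>

lemma length_square:
  assumes "reduced w" "w \<noteq> []"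
  shows "length w < length (reduce (w @ w))"
proof -
  obtain g c where w: "w = g @ c @ winv g" "cyclically_reduced c" "c \<noteq> []"
    using cyclic_reduction[OF assms(1)] assms(2) by metis
  have "reduced (g @ c @ c @ winv g)"
    using assms(1) w by (auto simp: cyclically_reduced_iff reduced_append)
  moreover have "reduce (w @ w) = reduce (g @ c @ c @ winv g)"
    using reduce_cancel_winv[of "g @ c" g "c @ winv g"] w by simp
  ultimately show ?thesis using w by (simp add: reduce_reduced)
qed

text \<open>
  Conjugating by the last letter \<open>t\<close> of \<open>g\<close> either cancels at one end of \<open>w\<close>, which rotates
  \<open>w\<close>, or cancels nowhere, and then \<open>g w g\<^sup>-\<^sup>1\<close> is already reduced.
\<close>

lemma conjugate_is_conjugated_rotation:
  assumes "cyclically_reduced w" "w \<noteq> []" "reduced g"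
  shows "\<exists>k h. reduce (g @ w @ winv g) = h @ rotate k w @ winv h"
  using assms
proof (induction g arbitrary: w rule: rev_induct)
  case Nil
  then show ?case
    by (intro exI[of _ 0] exI[of _ "[]"]) (simp add: reduce_reduced cyclically_reduced_def)
next
  case (snoc t g)
  have g: "reduced g" using snoc.prems by (simp add: reduced_append)
  consider "hd w = inv_letter t" | "last w = t" | "hd w \<noteq> inv_letter t" "last w \<noteq> t" by blast
  then show ?case
  proof cases
    case 1
    then obtain v where v: "w = inv_letter t # v" using snoc.prems by (cases w) auto
    have r: "rotate 1 w = v @ [inv_letter t]" using v by simp
    have "reduce ((g @ [t]) @ w @ winv (g @ [t])) = reduce (g @ rotate 1 w @ winv g)"
      using reduce_cancel[of g "[t]" "v @ [inv_letter t] @ winv g"] v r by simp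
    moreover obtain k h where "reduce (g @ rotate 1 w @ winv g) = h @ rotate k (rotate 1 w) @ winv h"
      using snoc.IH[OF cyclically_reduced_rotate[OF snoc.prems(1), of 1] _ g] snoc.prems by auto
    ultimately show ?thesis unfolding rotate_rotate by metis
  next
    case 2
    then obtain v where v: "w = v @ [t]" using snoc.prems by (cases w rule: rev_cases) auto
    have r: "rotate (length v) w = t # v" using v rotate_append[of v "[t]"] by simp
    have "reduce ((g @ [t]) @ w @ winv (g @ [t])) = reduce (g @ rotate (length v) w @ winv g)"
      using reduce_cancel[of "g @ [t] @ v" "[t]" "winv g"] v r by simp
    moreover obtain k h where
      "reduce (g @ rotate (length v) w @ winv g) = h @ rotate k (rotate (length v) w) @ winv h"
      using snoc.IH[OF cyclically_reduced_rotate[OF snoc.prems(1), of "length v"] _ g] snoc.prems by auto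
    ultimately show ?thesis unfolding rotate_rotate by metis
  next
    case 3
    have "reduced ((g @ [t]) @ w @ winv (g @ [t]))"
      using 3 snoc.prems g by (auto simp: reduced_append reduced_Cons cyclically_reduced_def hd_winv)
    then show ?thesis
      by (intro exI[of _ 0] exI[of _ "g @ [t]"]) (simp add: reduce_reduced)
  qed
qed

lemma cyclically_reduced_conjugated_imp_Nil:
  assumes "cyclically_reduced (h @ c @ winv h)" "c \<noteq> []"
  shows "h = []"
  using assms by (cases h) (auto simp: cyclically_reduced_def)

text \<open>
  A word \<open>h c h\<^sup>-\<^sup>1\<close> with nonempty \<open>h\<close> begins and ends with inverse letters, so the conjugator left
  over by the preceding lemmas is trivial.
\<close>

lemma cyclically_reduced_conjugates:
  assumes "cyclically_reduced w" "w \<noteq> []" "reduced g" "cyclically_reduced (reduce (g @ w @ winv g))"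
  shows "\<exists>k. reduce (g @ w @ winv g) = rotate k w"
proof -
  obtain k h where *: "reduce (g @ w @ winv g) = h @ rotate k w @ winv h"
    using conjugate_is_conjugated_rotation[OF assms(1-3)] by blast
  then have "h = []"
    using cyclically_reduced_conjugated_imp_Nil[of h "rotate k w"] assms by simp
  then show ?thesis using * by auto
qed

section \<open>Free groups, their homomorphisms and automorphisms\<close>

lemma carrier_free_group [simp]: "carrier (free_group X) = reduced_words X"
  by (simp add: free_group_def)

lemma mult_free_group [simp]: "u \<otimes>\<^bsub>free_group X\<^esub> v = reduce (u @ v)"
  by (simp add: free_group_def)

lemma one_free_group [simp]: "\<one>\<^bsub>free_group X\<^esub> = []"
  by (simp add: free_group_def)

lemma reduced_words_iff: "w \<in> reduced_words X \<longleftrightarrow> reduced w \<and> fst ` set w \<subseteq> X"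
  by (auto simp: reduced_words_def)

lemma winv_in_reduced_words: "w \<in> reduced_words X \<Longrightarrow> winv w \<in> reduced_words X"
  by (simp add: reduced_words_iff)

lemma inv_free_group: "w \<in> reduced_words X \<Longrightarrow> inv\<^bsub>free_group X\<^esub> w = winv w"
  by (rule group.inv_equality[OF group_free_group]) (auto simp: winv_in_reduced_words)

text \<open>
  The homomorphism from the free group on the domain of \<open>f\<close> that the universal property attaches
  to \<open>f\<close>; taking \<open>f\<close> to be the identity recovers evaluation of words.
\<close>

definition lift :: "('g, 'b) monoid_scheme \<Rightarrow> ('a \<Rightarrow> 'g) \<Rightarrow> 'a word \<Rightarrow> 'g" where
  "lift G f w = eval_word G (map (map_prod f id) w)"

lemma eval_word_eq_lift: "eval_word G w = lift G id w"
  by (simp add: lift_def map_prod.id)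

lemma lift_Nil [simp]: "lift G f [] = \<one>\<^bsub>G\<^esub>"
  by (simp add: lift_def eval_word_def)

lemma lift_Cons:
  "lift G f ((x, b) # w) = (if b then inv\<^bsub>G\<^esub> f x else f x) \<otimes>\<^bsub>G\<^esub> lift G f w"
  by (simp add: lift_def eval_word_def)

lemma lift_cong: "(\<And>x. x \<in> fst ` set w \<Longrightarrow> f x = g x) \<Longrightarrow> lift G f w = lift G g w"
proof (induction w)
  case (Cons l w)
  then have "lift G f w = lift G g w" "f (fst l) = g (fst l)" by simp_all
  then show ?case by (cases l) (simp add: lift_Cons)
qed simp

context group
begin

lemma inv_mult_cancel [simp]:
  "x \<in> carrier G \<Longrightarrow> y \<in> carrier G \<Longrightarrow> inv x \<otimes> (x \<otimes> y) = y"
  "x \<in> carrier G \<Longrightarrow> y \<in> carrier G \<Longrightarrow> x \<otimes> (inv x \<otimes> y) = y"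
  by (simp_all flip: m_assoc)

lemma lift_closed:
  "f ` fst ` set w \<subseteq> carrier G \<Longrightarrow> lift G f w \<in> carrier G"
  by (induction w) (auto simp: lift_Cons)

lemma lift_append:
  assumes "f ` fst ` set u \<subseteq> carrier G" "f ` fst ` set v \<subseteq> carrier G"
  shows "lift G f (u @ v) = lift G f u \<otimes> lift G f v"
  using assms(1)
proof (induction u)
  case Nil
  then show ?case using lift_closed[OF assms(2)] by simp
next
  case (Cons l u)
  then show ?case
    using lift_closed[OF assms(2)] lift_closed[of f u] by (cases l) (auto simp: lift_Cons m_assoc)
qed

lemma lift_push:
  assumes "f (fst l) \<in> carrier G" "f ` fst ` set w \<subseteq> carrier G"
  shows "lift G f (push l w) = lift G f (l # w)"
proof (cases w)
  case (Cons l' v)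
  then show ?thesis
    using assms lift_closed[of f v] by (cases l; cases l') (auto simp: lift_Cons)
qed simp

lemma fst_set_reduce: "fst ` set (reduce w) \<subseteq> fst ` set w"
  using foldr_push_in[of w "fst ` set w" "[]"] by (simp add: reduce_def reduced_words_iff)

text \<open>
  Cancelling a letter against its inverse does not change the value in a group; this is what makes
  \<open>lift\<close> multiplicative on reduced words.
\<close>

lemma lift_reduce:
  assumes "f ` fst ` set w \<subseteq> carrier G"
  shows "lift G f (reduce w) = lift G f w"
  using assms
proof (induction w)
  case Nil
  then show ?case by (simp add: reduce_def)
next
  case (Cons l w)
  have "f ` fst ` set (reduce w) \<subseteq> carrier G" using fst_set_reduce[of w] Cons.prems
    by (meson image_mono order.trans set_subset_Cons)
  then have "lift G f (push l (reduce w)) = lift G f (l # reduce w)"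
    using Cons.prems by (intro lift_push) auto
  also have "\<dots> = lift G f (l # w)"
    using Cons by (cases l) (simp add: lift_Cons)
  finally show ?case by (simp add: reduce_def)
qed

lemma lift_hom:
  assumes "f ` X \<subseteq> carrier G"
  shows "lift G f \<in> hom (free_group X) G"
proof (rule homI)
  fix u assume "u \<in> carrier (free_group X)"
  then show "lift G f u \<in> carrier G"
    using assms by (intro lift_closed) (auto simp: reduced_words_iff)
next
  fix u v assume "u \<in> carrier (free_group X)" "v \<in> carrier (free_group X)"
  then have "fst ` set u \<subseteq> X" "fst ` set v \<subseteq> X" by (auto simp: reduced_words_iff)
  then have *: "f ` fst ` set u \<subseteq> carrier G" "f ` fst ` set v \<subseteq> carrier G"
    using assms by blast+
  then have "f ` fst ` set (u @ v) \<subseteq> carrier G"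
    by (simp only: set_append image_Un Un_subset_iff)
  then show "lift G f (u \<otimes>\<^bsub>free_group X\<^esub> v) = lift G f u \<otimes> lift G f v"
    using * by (simp add: lift_reduce lift_append)
qed

lemma lift_generator [simp]: "f x \<in> carrier G \<Longrightarrow> lift G f [(x, False)] = f x"
  by (simp add: lift_Cons)

text \<open>
  A homomorphism is determined by its values on the generators. It serves to check on generators
  that two substitutions are inverse to each other.
\<close>

lemma free_group_hom_eq_lift:
  assumes "h \<in> hom (free_group X) G" "w \<in> reduced_words X"
  shows "h w = lift G (\<lambda>x. h [(x, False)]) w"
proof -
  interpret H: group_hom "free_group X" G h
    using assms(1) group_free_group by (simp add: group_hom_def group_hom_axioms_def is_group)
  show ?thesis
    using assms(2)
  proof (induction w)
    case Nil
    then show ?case using H.hom_one by simp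
  next
    case (Cons l w)
    obtain x b where l: "l = (x, b)" by force
    have x: "x \<in> X" and w: "w \<in> reduced_words X" using Cons.prems l by (auto simp: reduced_words_Cons)
    then have gx: "[(x, c)] \<in> reduced_words X" for c by (simp add: reduced_words_Cons)
    have "inv\<^bsub>free_group X\<^esub> [(x, False)] = [(x, True)]"
      using inv_free_group[OF gx] by simp
    then have hx: "h [(x, b)] = (if b then inv (h [(x, False)]) else h [(x, False)])"
      using H.hom_inv[of "[(x, False)]"] gx by auto
    have "h (l # w) = h ([l] \<otimes>\<^bsub>free_group X\<^esub> w)"
      using Cons.prems by (simp add: reduce_id)
    also have "\<dots> = h [l] \<otimes> h w"
      using gx w l by (intro H.hom_mult) auto
    finally show ?case using Cons.IH[OF w] hx l by (simp add: lift_Cons)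
  qed
qed

lemma generate_eq_eval_word:
  assumes "B \<subseteq> carrier G"
  shows "generate G B = eval_word G ` reduced_words B"
proof
  have hom: "eval_word G \<in> hom (free_group B) G"
    using lift_hom[of id B] assms unfolding eval_word_eq_lift[abs_def] by simp
  interpret H: group_hom "free_group B" G "eval_word G"
    using hom group_free_group by (simp add: group_hom_def group_hom_axioms_def is_group)
  show "generate G B \<subseteq> eval_word G ` reduced_words B"
  proof (rule generate_subgroup_incl)
    show "subgroup (eval_word G ` reduced_words B) G"
      using H.img_is_subgroup by simp
    show "B \<subseteq> eval_word G ` reduced_words B"
    proof
      fix b assume b: "b \<in> B"
      then have "eval_word G [(b, False)] = b"
        using assms by (auto simp: eval_word_eq_lift)
      then show "b \<in> eval_word G ` reduced_words B"
        using b by (metis fst_conv image_eqI reduced_words_Cons reduced_words_Nil)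
    qed
  qed
  show "eval_word G ` reduced_words B \<subseteq> generate G B"
  proof
    fix g assume "g \<in> eval_word G ` reduced_words B"
    then obtain w where w: "w \<in> reduced_words B" "g = eval_word G w" by blast
    have "eval_word G w \<in> generate G B"
      using w(1)
    proof (induction w)
      case Nil
      then show ?case by (simp add: eval_word_def generate.one)
    next
      case (Cons l w)
      then show ?case
        by (cases l) (auto simp: eval_word_def reduced_words_Cons intro: generate.intros)
    qed
    then show "g \<in> generate G B" using w by simp
  qed
qed

text \<open>
  Generation gives surjectivity, and the absence of relations gives a trivial kernel.
\<close>

lemma free_basis_iso:
  assumes "free_basis G B"
  shows "eval_word G \<in> iso (free_group B) G"
proof -
  have B: "B \<subseteq> carrier G" "generate G B = carrier G"
    and free: "\<And>w. w \<in> reduced_words B \<Longrightarrow> eval_word G w = \<one> \<Longrightarrow> w = []"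
    using assms by (auto simp: free_basis_def)
  have hom: "eval_word G \<in> hom (free_group B) G"
    using lift_hom[of id B] B unfolding eval_word_eq_lift[abs_def] by simp
  then interpret H: group_hom "free_group B" G "eval_word G"
    using group_free_group by (simp add: group_hom_def group_hom_axioms_def is_group)
  have "inj_on (eval_word G) (reduced_words B)"
  proof -
    have "eval_word G [] = \<one>" by (simp add: eval_word_def)
    then have "kernel (free_group B) G (eval_word G) = {\<one>\<^bsub>free_group B\<^esub>}"
      using free by (auto simp: kernel_def)
    then show ?thesis using H.trivial_ker_imp_inj by simp
  qed
  then show ?thesis
    using hom B generate_eq_eval_word[OF B(1)] by (auto simp: iso_def bij_betw_def)
qed

end

lemma lift_iso:
  assumes f: "f ` X \<subseteq> reduced_words X" and f': "f' ` X \<subseteq> reduced_words X"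
    and ff': "\<And>x. x \<in> X \<Longrightarrow> lift (free_group X) f (f' x) = [(x, False)]"
    and f'f: "\<And>x. x \<in> X \<Longrightarrow> lift (free_group X) f' (f x) = [(x, False)]"
  shows "lift (free_group X) f \<in> iso (free_group X) (free_group X)"
proof -
  let ?G = "free_group X"
  interpret group ?G by (rule group_free_group)
  have hom: "lift ?G f \<in> hom ?G ?G" "lift ?G f' \<in> hom ?G ?G"
    using lift_hom[of f X] lift_hom[of f' X] f f' by simp_all
  have id: "lift ?G h (lift ?G k w) = w"
    if "lift ?G h \<in> hom ?G ?G" "lift ?G k \<in> hom ?G ?G"
      "\<And>x. x \<in> X \<Longrightarrow> lift ?G h (k x) = [(x, False)]" "k ` X \<subseteq> reduced_words X" "w \<in> reduced_words X"
    for h k w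
  proof -
    have "lift ?G h \<circ> lift ?G k \<in> hom ?G ?G" by (rule Group.hom_compose[OF that(2,1)])
    then have "lift ?G h (lift ?G k w) = lift ?G (\<lambda>x. lift ?G h (lift ?G k [(x, False)])) w"
      using free_group_hom_eq_lift[of "lift ?G h \<circ> lift ?G k" X w] that(5) by simp
    also have "\<dots> = lift ?G (\<lambda>x. [(x, False)]) w"
    proof (rule lift_cong)
      fix x assume "x \<in> fst ` set w"
      then have "x \<in> X" using that(5) by (auto simp: reduced_words_iff)
      moreover from this have "lift ?G k [(x, False)] = k x"
        using that(4) by (intro lift_generator) auto
      ultimately show "lift ?G h (lift ?G k [(x, False)]) = [(x, False)]"
        using that(3) by simp
    qed
    also have "\<dots> = w"
      using free_group_hom_eq_lift[of "\<lambda>w. w" X w] that(5) by (simp add: hom_def)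
    finally show ?thesis .
  qed
  have "bij_betw (lift ?G f) (reduced_words X) (reduced_words X)"
  proof (rule bij_betwI)
    show "lift ?G f \<in> reduced_words X \<rightarrow> reduced_words X" "lift ?G f' \<in> reduced_words X \<rightarrow> reduced_words X"
      using hom by (auto simp: hom_def)
    show "lift ?G f' (lift ?G f w) = w" if "w \<in> reduced_words X" for w
      using id[OF hom(2,1) f'f f that] by simp
    show "lift ?G f (lift ?G f' w) = w" if "w \<in> reduced_words X" for w
      using id[OF hom ff' f' that] by simp
  qed
  then show ?thesis using hom by (simp add: iso_def)
qed

text \<open>
  A reduced word over \<open>\<phi> ` B\<close> is the letterwise image of a reduced word over \<open>B\<close> because \<open>\<phi>\<close> is
  injective, and a relation between images pulls back to a relation in \<open>B\<close>.
\<close>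

lemma iso_image_free_basis:
  assumes "group G" "group H" "\<phi> \<in> iso G H" "free_basis G B"
  shows "free_basis H (\<phi> ` B)"
proof -
  interpret G: group G by fact
  interpret H: group H by fact
  have B: "B \<subseteq> carrier G" "generate G B = carrier G"
    and free: "\<And>w. w \<in> reduced_words B \<Longrightarrow> eval_word G w = \<one>\<^bsub>G\<^esub> \<Longrightarrow> w = []"
    using assms by (auto simp: free_basis_def)
  interpret \<phi>: group_hom G H \<phi>
    using assms by (simp add: group_hom_def group_hom_axioms_def iso_def)
  have inj: "inj_on \<phi> (carrier G)" and surj: "\<phi> ` carrier G = carrier H"
    using assms(3) by (auto simp: iso_def bij_betw_def)
  have gen: "generate H (\<phi> ` B) = carrier H"
    using \<phi>.generate_img[OF B(1)] B(2) surj by simp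
  let ?p = "map (\<lambda>(h, e). (inv_into B \<phi> h, e))"
  have injB: "inj_on \<phi> B" using inj B(1) by (rule inj_on_subset)
  have "w = []" if "w \<in> reduced_words (\<phi> ` B)" "eval_word H w = \<one>\<^bsub>H\<^esub>" for w
  proof -
    have *: "?p w \<in> reduced_words B \<and> eval_word H w = \<phi> (eval_word G (?p w))"
      using that(1)
    proof (induction w)
      case Nil
      then show ?case by (simp add: eval_word_def)
    next
      case (Cons l w)
      obtain b e where l: "l = (\<phi> b, e)" and b: "b \<in> B"
        using Cons.prems by (cases l) (auto simp: reduced_words_Cons)
      have w: "w \<in> reduced_words (\<phi> ` B)" using Cons.prems by (simp add: reduced_words_Cons)
      note IH = Cons.IH[OF w]
      have inv_b: "inv_into B \<phi> (\<phi> b) = b" using injB b by simp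
      have "?p (l # w) \<in> reduced_words B"
      proof (cases w)
        case (Cons l' w')
        obtain c d where l': "l' = (\<phi> c, d)" and c: "c \<in> B"
          using w Cons by (cases l') (auto simp: reduced_words_Cons)
        have "inv_into B \<phi> (\<phi> c) = c" using injB c by simp
        then show ?thesis using IH Cons.prems Cons l l' b c inv_b by (auto simp: reduced_words_Cons)
      qed (use b l inv_b in \<open>simp add: reduced_words_Cons\<close>)
      moreover have "eval_word G (?p w) \<in> carrier G"
        using G.generate_eq_eval_word[OF B(1)] IH B(2) by blast
      ultimately show ?case using IH l inv_b b B(1) by (auto simp: eval_word_def)
    qed
    have "eval_word G (?p w) \<in> carrier G"
      using G.generate_eq_eval_word[OF B(1)] * B(2) by blast
    then have "eval_word G (?p w) = \<one>\<^bsub>G\<^esub>"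
      using * that(2) inj by (metis G.one_closed \<phi>.hom_one inj_onD)
    then show "w = []" using free * by blast
  qed
  then show ?thesis
    using gen B(1) by (auto simp: free_basis_def)
qed

lemma iso_primitive:
  "group G \<Longrightarrow> group H \<Longrightarrow> \<phi> \<in> iso G H \<Longrightarrow> primitive G g \<Longrightarrow> primitive H (\<phi> g)"
  unfolding primitive_def using iso_image_free_basis by (metis image_eqI)

lemma (in group) conjugation_iso:
  assumes "g \<in> carrier G"
  shows "(\<lambda>h. g \<otimes> h \<otimes> inv g) \<in> iso G G"
proof -
  have "bij_betw (\<lambda>h. g \<otimes> h \<otimes> inv g) (carrier G) (carrier G)"
    using assms by (intro bij_betwI[where g = "\<lambda>h. inv g \<otimes> h \<otimes> g"]) (auto simp: m_assoc)
  then show ?thesis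
    using assms by (auto simp: iso_def hom_def m_assoc)
qed

lemma primitive_in_carrier: "primitive G g \<Longrightarrow> g \<in> carrier G"
  by (auto simp: primitive_def free_basis_def)

lemma primitive_conjugate:
  assumes "primitive (free_group X) w" "g \<in> reduced_words X"
  shows "primitive (free_group X) (reduce (g @ w @ winv g))"
proof -
  have "primitive (free_group X) (g \<otimes>\<^bsub>free_group X\<^esub> w \<otimes>\<^bsub>free_group X\<^esub> inv\<^bsub>free_group X\<^esub> g)"
    using iso_primitive[OF group_free_group group_free_group
        group.conjugation_iso[OF group_free_group] assms(1), of g] assms(2) by simp
  then show ?thesis using assms(2) by (simp add: inv_free_group)
qed

section \<open>Nielsen equivalence and Christoffel pairs\<close>

text \<open>
  The pairs that arise from \<open>(x, y)\<close> by Nielsen moves. Simultaneous conjugation is included as a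
  move: it does not affect conjugacy classes of components, and in the length reduction below it
  replaces the usual well-ordering of words of equal length.
\<close>

inductive nielsen :: "('g, 'b) monoid_scheme \<Rightarrow> 'g \<Rightarrow> 'g \<Rightarrow> 'g \<Rightarrow> 'g \<Rightarrow> bool" for G x y where
  refl: "nielsen G x y x y"
| swap: "nielsen G x y u v \<Longrightarrow> nielsen G x y v u"
| inv: "nielsen G x y u v \<Longrightarrow> nielsen G x y (inv\<^bsub>G\<^esub> u) v"
| mult: "nielsen G x y u v \<Longrightarrow> nielsen G x y (u \<otimes>\<^bsub>G\<^esub> v) v"
| conj: "nielsen G x y u v \<Longrightarrow> g \<in> carrier G \<Longrightarrow>
    nielsen G x y (g \<otimes>\<^bsub>G\<^esub> u \<otimes>\<^bsub>G\<^esub> inv\<^bsub>G\<^esub> g) (g \<otimes>\<^bsub>G\<^esub> v \<otimes>\<^bsub>G\<^esub> inv\<^bsub>G\<^esub> g)"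

text \<open>
  For \<open>p\<close> and \<open>q\<close> free generators these are, up to conjugation, the pairs of standard factors of
  Christoffel words: only positive products occur.
\<close>

inductive christoffel :: "('g, 'b) monoid_scheme \<Rightarrow> 'g \<Rightarrow> 'g \<Rightarrow> 'g \<Rightarrow> 'g \<Rightarrow> bool" for G p q where
  base: "christoffel G p q p q"
| left: "christoffel G p q U V \<Longrightarrow> christoffel G p q (U \<otimes>\<^bsub>G\<^esub> V) V"
| right: "christoffel G p q U V \<Longrightarrow> christoffel G p q U (U \<otimes>\<^bsub>G\<^esub> V)"

context group
begin

lemma nielsen_closed:
  assumes "nielsen G x y u v" "x \<in> carrier G" "y \<in> carrier G"
  shows "u \<in> carrier G \<and> v \<in> carrier G"
  using assms by induction auto

lemma nielsen_trans:
  assumes "nielsen G u v a b" "nielsen G x y u v"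
  shows "nielsen G x y a b"
  using assms by induction (auto intro: nielsen.intros)

lemma nielsen_inv_right: "nielsen G x y u v \<Longrightarrow> nielsen G x y u (inv v)"
  by (auto intro: nielsen.intros)

lemma nielsen_sym:
  assumes "nielsen G x y u v" "x \<in> carrier G" "y \<in> carrier G"
  shows "nielsen G u v x y"
  using assms
proof induction
  case refl
  show ?case by (rule nielsen.refl)
next
  case (swap u v)
  then show ?case by (meson nielsen.refl nielsen.swap nielsen_trans)
next
  case (inv u v)
  then have "u \<in> carrier G" using nielsen_closed by blast
  then have "nielsen G (inv u) v u v"
    using nielsen.inv[OF nielsen.refl, of G "inv u" v] by simp
  with inv show ?case using nielsen_trans by blast
next
  case (mult u v)
  then have c: "u \<in> carrier G" "v \<in> carrier G" using nielsen_closed by blast+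
  have "nielsen G (u \<otimes> v) v (u \<otimes> v \<otimes> inv v) (inv v)"
    by (intro nielsen.mult nielsen_inv_right nielsen.refl)
  then have "nielsen G (u \<otimes> v) v u v"
    using nielsen_inv_right[of "u \<otimes> v" v u "inv v"] c by (simp add: m_assoc)
  with mult show ?case using nielsen_trans by blast
next
  case (conj u v g)
  then have c: "u \<in> carrier G" "v \<in> carrier G" using nielsen_closed by blast+
  have "nielsen G (g \<otimes> u \<otimes> inv g) (g \<otimes> v \<otimes> inv g)
      (inv g \<otimes> (g \<otimes> u \<otimes> inv g) \<otimes> inv (inv g)) (inv g \<otimes> (g \<otimes> v \<otimes> inv g) \<otimes> inv (inv g))"
    by (intro nielsen.conj nielsen.refl) (use conj in simp)
  then have "nielsen G (g \<otimes> u \<otimes> inv g) (g \<otimes> v \<otimes> inv g) u v"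
    using c conj.hyps by (simp add: m_assoc)
  with conj show ?case using nielsen_trans by blast
qed

lemma nielsen_mult_right:
  assumes "nielsen G x y u v" "x \<in> carrier G" "y \<in> carrier G"
  shows "nielsen G x y u (u \<otimes> v)"
proof -
  have c: "u \<in> carrier G" "v \<in> carrier G" using nielsen_closed assms by blast+
  have "nielsen G x y (inv (inv v \<otimes> inv u)) (inv (inv u))"
    using assms by (intro nielsen.inv nielsen_inv_right nielsen.mult) (auto intro: nielsen.intros)
  then have "nielsen G x y (u \<otimes> v) u" using c by (simp add: inv_mult_group)
  then show ?thesis by (rule nielsen.swap)
qed

text \<open>
  Inversions and multiplications can be undone inside the subgroup generated by the new pair, and
  conjugation is an automorphism.
\<close>

lemma nielsen_generate:
  assumes "nielsen G x y u v" "x \<in> carrier G" "y \<in> carrier G" "generate G {x, y} = carrier G"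
  shows "generate G {u, v} = carrier G"
  using assms
proof induction
  case refl
  then show ?case by simp
next
  case (swap u v)
  then show ?case by (simp add: insert_commute)
next
  case (inv u v)
  then have c: "u \<in> carrier G" "v \<in> carrier G" using nielsen_closed by blast+
  have sub: "subgroup (generate G {inv u, v}) G" using c by (intro generate_is_subgroup) auto
  have "inv (inv u) \<in> generate G {inv u, v}" by (intro generate.inv) auto
  then have "generate G {u, v} \<subseteq> generate G {inv u, v}"
    using c sub by (intro generate_subgroup_incl) (auto intro: generate.incl)
  then show ?case using inv subgroup.subset[OF sub] by auto
next
  case (mult u v)
  then have c: "u \<in> carrier G" "v \<in> carrier G" using nielsen_closed by blast+
  have sub: "subgroup (generate G {u \<otimes> v, v}) G" using c by (intro generate_is_subgroup) auto
  have "(u \<otimes> v) \<otimes> inv v \<in> generate G {u \<otimes> v, v}"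
    by (intro generate.eng generate.incl generate.inv) auto
  then have "u \<in> generate G {u \<otimes> v, v}" using c by (simp add: m_assoc)
  then have "generate G {u, v} \<subseteq> generate G {u \<otimes> v, v}"
    using c sub by (intro generate_subgroup_incl) (auto intro: generate.incl)
  then show ?case using mult subgroup.subset[OF sub] by auto
next
  case (conj u v g)
  then have c: "u \<in> carrier G" "v \<in> carrier G" using nielsen_closed by blast+
  let ?c = "\<lambda>h. g \<otimes> h \<otimes> inv g"
  have iso: "?c \<in> iso G G" using conjugation_iso conj.hyps by blast
  then interpret c: group_hom G G ?c
    by (simp add: group_hom_def group_hom_axioms_def iso_def is_group)
  have "generate G (?c ` {u, v}) = ?c ` carrier G"
    using c.generate_img[of "{u, v}"] c conj by simp
  also have "\<dots> = carrier G" using iso by (auto simp: iso_def bij_betw_def)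
  finally show ?case by simp
qed

lemma christoffel_closed:
  assumes "christoffel G p q U V" "p \<in> carrier G" "q \<in> carrier G"
  shows "U \<in> carrier G \<and> V \<in> carrier G"
  using assms by induction auto

end

text \<open>
  Christoffel pairs over \<open>x\<^sup>\<plusminus>\<^sup>1, y\<^sup>\<plusminus>\<^sup>1\<close>, up to swaps, inversions and simultaneous conjugation.
\<close>

inductive christoffel_type :: "('g, 'b) monoid_scheme \<Rightarrow> 'g \<Rightarrow> 'g \<Rightarrow> 'g \<Rightarrow> 'g \<Rightarrow> bool" for G x y where
  base: "p \<in> {x, inv\<^bsub>G\<^esub> x} \<Longrightarrow> q \<in> {y, inv\<^bsub>G\<^esub> y} \<Longrightarrow> christoffel G p q U V \<Longrightarrow>
    christoffel_type G x y U V"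
| swap: "christoffel_type G x y u v \<Longrightarrow> christoffel_type G x y v u"
| inv: "christoffel_type G x y u v \<Longrightarrow> christoffel_type G x y (inv\<^bsub>G\<^esub> u) v"
| conj: "christoffel_type G x y u v \<Longrightarrow> g \<in> carrier G \<Longrightarrow>
    christoffel_type G x y (g \<otimes>\<^bsub>G\<^esub> u \<otimes>\<^bsub>G\<^esub> inv\<^bsub>G\<^esub> g) (g \<otimes>\<^bsub>G\<^esub> v \<otimes>\<^bsub>G\<^esub> inv\<^bsub>G\<^esub> g)"

context group
begin

context
  fixes x y
  assumes xy: "x \<in> carrier G" "y \<in> carrier G"
begin

lemma christoffel_typeI:
  assumes "christoffel G p q U V" "p \<in> {x, inv x}" "q \<in> {y, inv y}"
  shows "christoffel_type G x y U V"
  using assms christoffel_type.base by metis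

lemma christoffel_type_closed:
  assumes "christoffel_type G x y u v"
  shows "u \<in> carrier G \<and> v \<in> carrier G"
  using assms
proof induction
  case (base p q U V)
  then have "p \<in> carrier G" "q \<in> carrier G" using xy by auto
  then show ?case using christoffel_closed[OF base(3)] by blast
qed auto

lemma christoffel_type_inv_right:
  "christoffel_type G x y u v \<Longrightarrow> christoffel_type G x y u (inv v)"
  by (intro christoffel_type.swap[OF christoffel_type.inv[OF christoffel_type.swap]])

lemma christoffel_type_conjD:
  assumes "christoffel_type G x y (inv h \<otimes> u \<otimes> h) (inv h \<otimes> v \<otimes> h)"
    "h \<in> carrier G" "u \<in> carrier G" "v \<in> carrier G"
  shows "christoffel_type G x y u v"
  using christoffel_type.conj[OF assms(1,2)] assms(2-4) by (simp add: m_assoc)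

text \<open>
  Here the negative products are absorbed. If the pair was built by a positive rule, the quotient
  undoes that rule, possibly after a conjugation. The only other case is \<open>(p, q)\<close> itself, where
  \<open>p q\<^sup>-\<^sup>1\<close> is a positive product over the changed generators \<open>p\<close> and \<open>q\<^sup>-\<^sup>1\<close>.
\<close>

lemma christoffel_type_of_quotients:
  assumes "christoffel G p q U V" "p \<in> {x, inv x}" "q \<in> {y, inv y}"
  shows "christoffel_type G x y (U \<otimes> inv V) V" "christoffel_type G x y (V \<otimes> inv U) U"
proof -
  have pq: "p \<in> carrier G" "q \<in> carrier G" using assms xy by auto
  have "christoffel_type G x y (U \<otimes> inv V) V \<and> christoffel_type G x y (V \<otimes> inv U) U"
    using assms(1)
  proof cases
    case base
    have q': "inv q \<in> {y, inv y}" and p': "inv p \<in> {x, inv x}" using assms xy by auto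
    have "christoffel_type G x y (p \<otimes> inv q) (inv q)"
      by (rule christoffel_typeI[OF christoffel.left[OF christoffel.base] assms(2) q'])
    then have 1: "christoffel_type G x y (p \<otimes> inv q) q"
      using christoffel_type_inv_right pq by fastforce
    have "christoffel_type G x y (inv p) (inv p \<otimes> q)"
      by (rule christoffel_typeI[OF christoffel.right[OF christoffel.base] p' assms(3)])
    then have "christoffel_type G x y p (inv p \<otimes> q)"
      using christoffel_type.inv[of G x y "inv p"] pq by simp
    then have "christoffel_type G x y (p \<otimes> p \<otimes> inv p) (p \<otimes> (inv p \<otimes> q) \<otimes> inv p)"
      using christoffel_type.conj[OF _ pq(1)] by blast
    then have "christoffel_type G x y (q \<otimes> inv p) p"
      using christoffel_type.swap pq by (simp add: m_assoc)
    with 1 base show ?thesis by simp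
  next
    case (left U')
    have c: "U' \<in> carrier G" "V \<in> carrier G" using christoffel_closed[OF left(2)] pq by auto
    have "christoffel_type G x y U' V" using christoffel_typeI[OF left(2)] assms by simp
    moreover have "christoffel_type G x y U' (U' \<otimes> V)"
      using christoffel_typeI[OF christoffel.right[OF left(2)]] assms by simp
    then have "christoffel_type G x y (inv U') (U' \<otimes> V)" by (rule christoffel_type.inv)
    ultimately show ?thesis using left c by (simp add: m_assoc inv_mult_group)
  next
    case (right V')
    have c: "U \<in> carrier G" "V' \<in> carrier G" using christoffel_closed[OF right(2)] pq by auto
    have 1: "christoffel_type G x y (inv U \<otimes> (V \<otimes> inv U) \<otimes> U) (inv U \<otimes> U \<otimes> U)"
      using christoffel_type.swap[OF christoffel_typeI[OF right(2)]] assms right c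
      by (simp add: m_assoc)
    have "christoffel_type G x y (U \<otimes> V') V'"
      using christoffel_typeI[OF christoffel.left[OF right(2)]] assms by simp
    then have "christoffel_type G x y (inv V' ) (U \<otimes> V')"
      by (rule christoffel_type.inv[OF christoffel_type.swap])
    then have "christoffel_type G x y (V' \<otimes> inv V' \<otimes> inv V') (V' \<otimes> (U \<otimes> V') \<otimes> inv V')"
      using christoffel_type.conj[OF _ c(2)] by blast
    then have "christoffel_type G x y (inv U \<otimes> (U \<otimes> inv V) \<otimes> U) (inv U \<otimes> V \<otimes> U)"
      using right c by (simp add: m_assoc inv_mult_group)
    then show ?thesis
      using 1 right c christoffel_type_conjD[of U] by simp
  qed
  then show "christoffel_type G x y (U \<otimes> inv V) V" "christoffel_type G x y (V \<otimes> inv U) U" by auto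
qed

text \<open>
  The induction needs all four statements at once: a swap exchanges the roles of the two words and
  an inversion exchanges products with quotients.
\<close>

lemma christoffel_type_mult:
  assumes "christoffel_type G x y u v"
  shows "christoffel_type G x y (u \<otimes> v) v"
proof -
  have "christoffel_type G x y (u \<otimes> v) v \<and> christoffel_type G x y (u \<otimes> inv v) v \<and>
    christoffel_type G x y (v \<otimes> u) u \<and> christoffel_type G x y (v \<otimes> inv u) u"
    using assms
  proof induction
    case (base p q U V)
    then have "p \<in> carrier G" "q \<in> carrier G" using xy by auto
    then have UV: "U \<in> carrier G" "V \<in> carrier G" using christoffel_closed[OF base(3)] by auto
    have "christoffel_type G x y (inv (inv U) \<otimes> (V \<otimes> U) \<otimes> inv U) (inv (inv U) \<otimes> U \<otimes> inv U)"
      using christoffel_type.swap[OF christoffel_typeI[OF christoffel.right[OF base(3)] base(1,2)]] UV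
      by (simp add: m_assoc)
    then have "christoffel_type G x y (V \<otimes> U) U"
      by (rule christoffel_type_conjD) (use UV in auto)
    moreover have "christoffel_type G x y (U \<otimes> V) V"
      by (rule christoffel_typeI[OF christoffel.left[OF base(3)] base(1,2)])
    ultimately show ?case using christoffel_type_of_quotients[OF base(3,1,2)] by blast
  next
    case (swap u v)
    then show ?case by blast
  next
    case (inv u v)
    then have c: "u \<in> carrier G" "v \<in> carrier G" using christoffel_type_closed by blast+
    have "christoffel_type G x y (inv (inv v) \<otimes> (inv u \<otimes> v) \<otimes> inv v) (inv (inv v) \<otimes> v \<otimes> inv v)"
      using christoffel_type.inv[of G x y "u \<otimes> inv v" v] inv.IH c by (simp add: m_assoc inv_mult_group)
    then have 1: "christoffel_type G x y (inv u \<otimes> v) v"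
      by (rule christoffel_type_conjD) (use c in auto)
    have "christoffel_type G x y (inv v \<otimes> (inv u \<otimes> inv v) \<otimes> v) (inv v \<otimes> v \<otimes> v)"
      using christoffel_type.inv[of G x y "u \<otimes> v" v] inv.IH c by (simp add: m_assoc inv_mult_group)
    then have 2: "christoffel_type G x y (inv u \<otimes> inv v) v"
      by (rule christoffel_type_conjD) (use c in auto)
    show ?case using 1 2 inv.IH christoffel_type_inv_right c by simp
  next
    case (conj u v g)
    then have c: "u \<in> carrier G" "v \<in> carrier G" using christoffel_type_closed by blast+
    note IH = conj.IH[THEN conjunct1] conj.IH[THEN conjunct2, THEN conjunct1]
      conj.IH[THEN conjunct2, THEN conjunct2, THEN conjunct1]
      conj.IH[THEN conjunct2, THEN conjunct2, THEN conjunct2]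
    note 1 = IH[THEN christoffel_type.conj[OF _ conj.hyps(2)]]
    show ?case using 1 c conj.hyps(2) by (simp add: m_assoc inv_mult_group)
  qed
  then show ?thesis by blast
qed

theorem nielsen_imp_christoffel_type:
  assumes "nielsen G x y u v"
  shows "christoffel_type G x y u v"
  using assms
proof induction
  case refl
  show ?case by (rule christoffel_typeI[OF christoffel.base]) simp_all
next
  case (swap u v)
  show ?case by (rule christoffel_type.swap[OF swap.IH])
next
  case (inv u v)
  show ?case by (rule christoffel_type.inv[OF inv.IH])
next
  case (mult u v)
  show ?case by (rule christoffel_type_mult[OF mult.IH])
next
  case (conj u v g)
  show ?case by (rule christoffel_type.conj[OF conj.IH conj.hyps(2)])
qed

end

end

section \<open>Nielsen reduction of generating pairs\<close>

text \<open>
  The product has the length of \<open>a\<close> exactly when half of \<open>b\<close> cancels. Writing the halves of \<open>b\<close> as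
  \<open>p\<close> and \<open>q\<^sup>-\<^sup>1\<close> makes the situation symmetric under inversion of \<open>b\<close>.
\<close>

lemma half_cancellation:
  assumes "reduced a" "reduced b" "length (reduce (a @ b)) = length a"
  obtains r p q where "a = r @ winv p" "b = p @ winv q" "length p = length q" "reduce (a @ b) = r @ winv q"
proof -
  obtain r s t where 1: "a = r @ s" "b = winv s @ t" "reduce (a @ b) = r @ t"
    using reduced_product_cases[OF assms(1,2)] by blast
  then have "length s = length t" using assms(3) by simp
  then show ?thesis using that[of r "winv s" "winv t"] 1 by simp
qed

lemma winv_product:
  assumes "reduced u" "reduced v"
  shows "winv (reduce (u @ v)) = reduce (winv v @ winv u)"
proof -
  obtain p s q where 1: "u = p @ s" "v = winv s @ q" "reduced (p @ q)" "reduce (u @ v) = p @ q"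
    using reduced_product_cases[OF assms] by blast
  have "reduce (winv v @ winv u) = reduce (winv (p @ q))"
    using reduce_cancel[of "winv q" s "winv p"] 1(1,2) by simp
  also have "\<dots> = winv (p @ q)" by (rule reduce_reduced) (simp only: reduced_winv 1(3))
  finally show ?thesis using 1(4) by simp
qed

lemma length_product_winv:
  "reduced u \<Longrightarrow> reduced v \<Longrightarrow> length (reduce (winv v @ winv u)) = length (reduce (u @ v))"
  using winv_product[of u v] length_winv[of "reduce (u @ v)"] by simp

text \<open>
  The end of \<open>a\<close> would be inverse to the first half \<open>p\<close> of \<open>b\<close> and also to the first half \<open>q\<close> of
  \<open>b\<^sup>-\<^sup>1\<close>, so that \<open>b = p p\<^sup>-\<^sup>1\<close>.
\<close>

lemma no_half_cancellation_both_ends: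
  assumes "reduced a" "reduced b" "b \<noteq> []"
    and "length (reduce (a @ b)) = length a" "length (reduce (a @ winv b)) = length a"
  shows False
proof -
  obtain r p q where 1: "a = r @ winv p" "b = p @ winv q" "length p = length q"
    using half_cancellation[OF assms(1,2,4)] by metis
  obtain r' p' q' where 2: "a = r' @ winv p'" "winv b = p' @ winv q'" "length p' = length q'"
    using half_cancellation[OF assms(1) _ assms(5)] assms(2) by (metis reduced_winv)
  have "length b = 2 * length p" using 1(2,3) by simp
  moreover have "length b = 2 * length p'" using 2(2,3) by (metis length_append length_winv mult_2)
  ultimately have len: "length p = length p'" by simp
  have "p' = q" using 1(2) 2(2,3) len by (simp add: 1(3))
  moreover have "p' = p" using 1(1) 2(1) len by (metis append_eq_append_conv length_winv winv_winv)
  ultimately have "b = p @ winv p" using 1(2) by simp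
  then have "reduce b = []" by simp
  then show False using assms(2,3) by (simp add: reduce_reduced)
qed

text \<open>
  A pair of nontrivial words whose total length no sequence of moves can decrease.
\<close>

locale minimal_pair =
  fixes X :: "'a set" and u v
  assumes uv: "u \<in> reduced_words X" "v \<in> reduced_words X"
    and nonempty: "u \<noteq> []" "v \<noteq> []"
    and minimal: "\<And>u' v'. nielsen (free_group X) u v u' v' \<Longrightarrow> length u + length v \<le> length u' + length v'"
begin

lemma swap: "minimal_pair X v u"
  using uv nonempty minimal group.nielsen_trans[OF group_free_group, of X v u]
    nielsen.swap[OF nielsen.refl, of "free_group X" u v]
  by unfold_locales (auto simp: add.commute)

lemma inv_left: "minimal_pair X (winv u) v"
proof
  fix u' v' assume "nielsen (free_group X) (winv u) v u' v'"
  moreover have "nielsen (free_group X) u v (winv u) v"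
    using nielsen.inv[OF nielsen.refl, of "free_group X" u v] uv by (simp add: inv_free_group)
  ultimately have "nielsen (free_group X) u v u' v'"
    by (rule group.nielsen_trans[OF group_free_group])
  then show "length (winv u) + length v \<le> length u' + length v'" using minimal by simp
qed (use uv nonempty in \<open>auto simp: winv_in_reduced_words\<close>)

lemma product_left: "length u \<le> length (reduce (u @ v))"
  using minimal[OF nielsen.mult[OF nielsen.refl]] by simp

lemma product_right: "length v \<le> length (reduce (u @ v))"
  using minimal[OF group.nielsen_mult_right[OF group_free_group nielsen.refl]] uv by simp

text \<open>
  If half of \<open>v\<close> cancels at both ends of \<open>u\<close>, then \<open>u = q s p\<^sup>-\<^sup>1\<close> and \<open>v = p q\<^sup>-\<^sup>1\<close>. Multiplication
  gives \<open>u v = q s q\<^sup>-\<^sup>1\<close>, and conjugating \<open>(u v, v)\<close> by \<open>q\<^sup>-\<^sup>1\<close> produces the pair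
  \<open>(s, q\<^sup>-\<^sup>1 p)\<close>, whose total length is at most the length of \<open>u\<close>.
\<close>

lemma no_half_cancellation_twice:
  assumes "length (reduce (u @ v)) = length u" "length (reduce (v @ u)) = length u"
  shows False
proof -
  have red: "reduced u" "reduced v" using uv by (auto simp: reduced_words_iff)
  obtain r p q where 1: "u = r @ winv p" "v = p @ winv q" "length p = length q"
    "reduce (u @ v) = r @ winv q"
    using half_cancellation[OF red assms(1)] by metis
  have "length (reduce (winv u @ winv v)) = length (winv u)"
    using assms(2) length_product_winv[OF red(2,1)] by simp
  then obtain r' p' q' where 2: "winv u = r' @ winv p'" "winv v = p' @ winv q'" "length p' = length q'"
    using half_cancellation[of "winv u" "winv v"] red by (metis reduced_winv)
  have "length v = 2 * length p" using 1(2,3) by simp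
  moreover have "length v = 2 * length p'" using 2(2,3) by (metis length_append length_winv mult_2)
  ultimately have len: "length p' = length q" using 1(3) by simp
  have "winv v = q @ winv p" using 1(2) by simp
  then have "p' = q" using 2(2) len by simp
  have "u = q @ winv r'" using arg_cong[OF 2(1), of winv] \<open>p' = q\<close> by simp
  \<comment> \<open>This keeps the occurrences of \<open>q\<close> and \<open>p\<^sup>-\<^sup>1\<close> in \<open>u\<close> from overlapping.\<close>
  have "2 * length q \<le> length u"
    using product_right assms(1) 1(2,3) by simp
  then have "length q \<le> length r" using 1(1,3) by simp
  then obtain s where s: "r = q @ s"
    using \<open>u = q @ winv r'\<close> 1(1) by (metis append_eq_append_conv_if append_take_drop_id)
  have q: "winv q \<in> reduced_words X"
    using uv(1) \<open>u = q @ winv r'\<close> by (auto simp: reduced_words_iff reduced_append)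
  let ?G = "free_group X"
  have "nielsen ?G u v (winv q \<otimes>\<^bsub>?G\<^esub> (u \<otimes>\<^bsub>?G\<^esub> v) \<otimes>\<^bsub>?G\<^esub> inv\<^bsub>?G\<^esub> (winv q))
      (winv q \<otimes>\<^bsub>?G\<^esub> v \<otimes>\<^bsub>?G\<^esub> inv\<^bsub>?G\<^esub> (winv q))"
    using q by (intro nielsen.conj nielsen.mult nielsen.refl) simp
  then have n: "nielsen ?G u v (reduce (winv q @ u @ v @ q)) (reduce (winv q @ v @ q))"
    using q by (simp add: inv_free_group)
  have "reduce (winv q @ u @ v @ q) = reduce (winv q @ reduce (u @ v) @ q)"
    using reduce_reduce_inner[of "winv q" "u @ v" q] by simp
  also have "\<dots> = reduce s"
    using reduce_cancel_winv[of "[]" q "s @ winv q @ q"] reduce_cancel_winv[of s q "[]"]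
    unfolding 1(4) s by simp
  finally have "reduce (winv q @ u @ v @ q) = reduce s" .
  moreover have "reduce (winv q @ v @ q) = reduce (winv q @ p)"
    using reduce_cancel_winv[of "winv q @ p" q "[]"] 1(2) by simp
  moreover have "length (reduce s) \<le> length s" "length (reduce (winv q @ p)) \<le> length q + length p"
    using length_reduce_le[of s] length_reduce_le[of "winv q @ p"] by simp_all
  ultimately have "length u + length v \<le> length s + (length q + length p)"
    using minimal[OF n] by simp
  then show False using 1(1-3) s nonempty by simp
qed

definition signed where "signed = {u, winv u, v, winv v}"

lemma signed_reduced:
  assumes "a \<in> signed"
  shows "a \<in> reduced_words X" "reduced a" "a \<noteq> []"
proof -
  show "a \<in> reduced_words X" using assms uv by (auto simp: signed_def intro: winv_in_reduced_words)
  then show "reduced a" by (simp add: reduced_words_iff)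
  show "a \<noteq> []" using assms nonempty by (metis signed_def insertE singletonD winv_eq_Nil_iff)
qed

lemma signed_cases:
  assumes "a \<in> signed" "b \<in> signed"
  shows "a = b \<or> a = winv b \<or> minimal_pair X a b"
proof -
  interpret m1: minimal_pair X "winv u" v by (rule inv_left)
  interpret m2: minimal_pair X v u by (rule swap)
  interpret m3: minimal_pair X "winv v" u by (rule m2.inv_left)
  interpret m4: minimal_pair X "winv u" "winv v" using minimal_pair.inv_left[OF m3.swap] .
  show ?thesis
    using assms minimal_pair_axioms m1.minimal_pair_axioms m2.minimal_pair_axioms
      m3.minimal_pair_axioms m4.minimal_pair_axioms m1.swap m3.swap m4.swap
    unfolding signed_def by auto
qed

text \<open>
  Multiplying two different words is a move, and the square of a word is longer than the word.
\<close>

lemma signed_product: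
  assumes "a \<in> signed" "b \<in> signed" "b \<noteq> winv a"
  shows "length a \<le> length (reduce (a @ b))" "length b \<le> length (reduce (a @ b))"
proof -
  have "a \<noteq> winv b" using assms(3) by auto
  then consider "a = b" | "minimal_pair X a b" using signed_cases[OF assms(1,2)] by blast
  then have "length a \<le> length (reduce (a @ b)) \<and> length b \<le> length (reduce (a @ b))"
  proof cases
    case 1
    then show ?thesis using length_square[of a] signed_reduced[OF assms(1)] by simp
  next
    case 2
    then show ?thesis using minimal_pair.product_left minimal_pair.product_right by blast
  qed
  then show "length a \<le> length (reduce (a @ b))" "length b \<le> length (reduce (a @ b))" by auto
qed

text \<open>
  This is Nielsen's condition that the neighbours of \<open>b\<close> in a product never cancel all of \<open>b\<close>. If
  they did, each would cancel exactly half of \<open>b\<close>, so that \<open>a\<close> and \<open>c\<close> are both the other word of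
  the pair, up to inversion; the two cases \<open>c = a\<close> and \<open>c = a\<^sup>-\<^sup>1\<close> have been excluded above.
\<close>

lemma signed_triple:
  assumes "a \<in> signed" "b \<in> signed" "c \<in> signed" "b \<noteq> winv a" "c \<noteq> winv b"
  shows "length a + length c < length (reduce (a @ b)) + length (reduce (b @ c))"
proof (rule ccontr)
  assume "\<not> ?thesis"
  then have eq: "length (reduce (a @ b)) = length a" "length (reduce (b @ c)) = length c"
    using signed_product(1)[OF assms(1,2,4)] signed_product(2)[OF assms(2,3,5)] by auto
  have ne: "a \<noteq> b" "c \<noteq> b"
    using eq length_square[of b] signed_reduced[OF assms(2)] by auto
  have "a \<noteq> winv b" using assms(4) by auto
  then have 1: "minimal_pair X a b" using signed_cases[OF assms(1,2)] ne by blast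
  have 2: "minimal_pair X c b" using signed_cases[OF assms(3,2)] ne assms(5) by blast
  from 1 2 have "a = c \<or> a = winv c"
    using assms(1-3,4,5) ne unfolding signed_def by auto
  then show False
  proof
    assume "a = c"
    then show False using minimal_pair.no_half_cancellation_twice[OF 1] eq by simp
  next
    assume "a = winv c"
    then have "length (reduce (a @ winv b)) = length a"
      using eq(2) length_product_winv[of b c] signed_reduced(2)[OF assms(2)] signed_reduced(2)[OF assms(3)] by simp
    then show False
      using no_half_cancellation_both_ends[of a b] eq signed_reduced assms by blast
  qed
qed

definition letter_value :: "'a word \<times> bool \<Rightarrow> 'a word" where
  "letter_value l = (if snd l then winv (fst l) else fst l)"

lemma letter_value_signed: "fst l \<in> {u, v} \<Longrightarrow> letter_value l \<in> signed"
  by (auto simp: letter_value_def signed_def)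

text \<open>
  Adjacent letters of a reduced word over \<open>{u, v}\<close> have values that are not inverse to each other;
  for this the four signed words must be distinct.
\<close>

lemma letter_value_neq:
  assumes "fst l \<in> {u, v}" "fst l' \<in> {u, v}" "l' \<noteq> inv_letter l"
  shows "letter_value l' \<noteq> winv (letter_value l)"
proof -
  have "w \<noteq> winv w" if "w \<in> signed" for w
  proof
    assume "w = winv w"
    then have "reduce (w @ w) = []" by (metis reduce_winv(1))
    then show False using length_square[of w] signed_reduced[OF that] by simp
  qed
  then have self: "u \<noteq> winv u" "v \<noteq> winv v" by (simp_all add: signed_def)
  have "u \<noteq> winv v"
  proof
    assume "u = winv v"
    then show False using product_left nonempty by simp
  qed
  moreover have "u \<noteq> v"
  proof
    assume "u = v"
    then show False
      using minimal_pair.product_left[OF inv_left] nonempty by simp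
  qed
  ultimately have "winv u \<noteq> v" "winv v \<noteq> u" "u \<noteq> v" "winv u \<noteq> winv v" "winv u \<noteq> u" "winv v \<noteq> v"
    using self by (metis winv_winv)+
  then show ?thesis
    using assms self by (cases l; cases l') (auto simp: letter_value_def)
qed

lemma eval_word_Cons:
  assumes "fst l \<in> {u, v}"
  shows "eval_word (free_group X) (l # w) = reduce (letter_value l @ eval_word (free_group X) w)"
  using assms uv by (cases l) (auto simp: eval_word_def letter_value_def inv_free_group)

lemma eval_word_reduced: "w \<in> reduced_words {u, v} \<Longrightarrow> reduced (eval_word (free_group X) w)"
  by (cases w) (auto simp: eval_word_Cons reduced_words_Cons reduced_reduce eval_word_def)

text \<open>
  Since no factor is swallowed, lengths are determined by adjacent pairs, and prefixing a factor
  never shortens the value. The bound \<open>2\<close> for two factors comes from parity: if both factors had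
  length one, then their product would have even positive length.
\<close>

lemma length_eval_word:
  assumes "l # l' # w \<in> reduced_words {u, v}"
  shows "length (eval_word (free_group X) (l # l' # w)) + length (letter_value l') =
      length (reduce (letter_value l @ letter_value l')) + length (eval_word (free_group X) (l' # w)) \<and>
    2 \<le> length (eval_word (free_group X) (l # l' # w))"
  using assms
proof (induction w arbitrary: l l')
  case Nil
  then have l: "fst l \<in> {u, v}" "fst l' \<in> {u, v}" "l' \<noteq> inv_letter l"
    by (auto simp: reduced_words_Cons)
  note S = letter_value_signed[OF l(1)] letter_value_signed[OF l(2)]
  have 1: "eval_word (free_group X) [l'] = letter_value l'"
    using signed_reduced(2)[OF S(2)] l eval_word_Cons[of l' "[]"] by (simp add: eval_word_def reduce_reduced)
  then have 2: "eval_word (free_group X) [l, l'] = reduce (letter_value l @ letter_value l')"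
    using l eval_word_Cons[of l "[l']"] by simp
  have "length (letter_value l) > 0" "length (letter_value l') > 0" using signed_reduced(3) S by simp_all
  moreover have "even (length (reduce (letter_value l @ letter_value l')) + length (letter_value l) + length (letter_value l'))"
    by (intro even_length_product signed_reduced(2) S)
  ultimately have "2 \<le> length (reduce (letter_value l @ letter_value l'))"
    using signed_product[OF S letter_value_neq[OF l]] by presburger
  then show ?case using 1 2 by simp
next
  case (Cons l'' w)
  then have l: "fst l \<in> {u, v}" "fst l' \<in> {u, v}" "fst l'' \<in> {u, v}"
      "l' \<noteq> inv_letter l" "l'' \<noteq> inv_letter l'"
    and w: "l' # l'' # w \<in> reduced_words {u, v}"
    by (auto simp: reduced_words_Cons)
  note S = letter_value_signed[OF l(1)] letter_value_signed[OF l(2)] letter_value_signed[OF l(3)]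
  let ?z = "eval_word (free_group X) (l'' # w)"
  have yz: "eval_word (free_group X) (l' # l'' # w) = reduce (letter_value l' @ ?z)"
    by (simp only: eval_word_Cons[OF l(2)])
  have xyz: "eval_word (free_group X) (l # l' # l'' # w) = reduce (letter_value l @ letter_value l' @ ?z)"
    by (simp only: eval_word_Cons[OF l(1)] eval_word_Cons[OF l(2)] reduce_reduce_right)
  note IH = Cons.IH[OF w]
  have "length (letter_value l) + length (letter_value l'')
      < length (reduce (letter_value l @ letter_value l')) + length (reduce (letter_value l' @ letter_value l''))"
    using signed_triple[OF S letter_value_neq[OF l(1,2,4)] letter_value_neq[OF l(2,3,5)]] .
  then have "length (letter_value l) + length ?z < length (reduce (letter_value l @ letter_value l')) + length (reduce (letter_value l' @ ?z))"
    using IH unfolding yz by linarith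
  then have "length (reduce (letter_value l @ letter_value l' @ ?z)) + length (letter_value l') =
      length (reduce (letter_value l @ letter_value l')) + length (reduce (letter_value l' @ ?z))"
    using S w by (intro length_triple_product signed_reduced eval_word_reduced) (simp_all add: reduced_words_Cons)
  moreover have "length (letter_value l') \<le> length (reduce (letter_value l @ letter_value l'))"
    using signed_product(2)[OF S(1,2) letter_value_neq[OF l(1,2,4)]] .
  ultimately show ?case using IH unfolding xyz yz by linarith
qed

text \<open>
  By the preceding lemma a word of length one is not a product of two or more factors.
\<close>

lemma letter_in_signed:
  assumes "[l] \<in> generate (free_group X) {u, v}"
  shows "[l] \<in> signed"
proof -
  obtain w where w: "w \<in> reduced_words {u, v}" "[l] = eval_word (free_group X) w"
    using assms group.generate_eq_eval_word[OF group_free_group, of "{u, v}" X] uv by auto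
  show ?thesis
  proof (cases w)
    case Nil
    then show ?thesis using w by (simp add: eval_word_def)
  next
    case (Cons k w')
    show ?thesis
    proof (cases w')
      case Nil
      have k: "fst k \<in> {u, v}" using w Cons by (simp add: reduced_words_Cons)
      then have "[l] = letter_value k"
        using w(2) Cons Nil eval_word_Cons[OF k, of "[]"] signed_reduced(2)[OF letter_value_signed[OF k]]
        by (simp add: eval_word_def reduce_reduced)
      then show ?thesis using letter_value_signed[OF k] by simp
    next
      case Cons': (Cons k' w'')
      have "2 \<le> length (eval_word (free_group X) w)"
        using length_eval_word[of k k' w''] w(1) Cons Cons' by simp
      then show ?thesis using w(2)[symmetric] by simp
    qed
  qed
qed

end

section \<open>Exponent sums\<close>

definition expo :: "'a \<Rightarrow> 'a word \<Rightarrow> int" where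
  "expo x w = (\<Sum>(y, b)\<leftarrow>w. if y = x then (if b then - 1 else 1) else 0)"

lemma expo_Nil [simp]: "expo x [] = 0"
  by (simp add: expo_def)

lemma expo_Cons [simp]:
  "expo x ((y, b) # w) = (if y = x then (if b then - 1 else 1) else 0) + expo x w"
  by (simp add: expo_def)

lemma expo_append [simp]: "expo x (u @ v) = expo x u + expo x v"
  by (simp add: expo_def)

lemma expo_winv [simp]: "expo x (winv w) = - expo x w"
  by (induction w) auto

lemma expo_push: "expo x (push l w) = expo x (l # w)"
  by (cases l; cases w) (auto split: if_splits)

lemma expo_reduce [simp]: "expo x (reduce w) = expo x w"
proof (induction w)
  case (Cons l w)
  then show ?case by (cases l) (simp add: reduce_def expo_push)
qed (simp add: reduce_def)

lemma expo_rotate [simp]: "expo x (rotate k w) = expo x w"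
  unfolding rotate_drop_take
  by (metis add.commute append_take_drop_id expo_append)

text \<open>
  Homomorphisms to the integers, written additively.
\<close>

definition additive :: "'a set \<Rightarrow> ('a word \<Rightarrow> int) \<Rightarrow> bool" where
  "additive X f \<longleftrightarrow>
     (\<forall>u \<in> reduced_words X. \<forall>v \<in> reduced_words X. f (reduce (u @ v)) = f u + f v)"

lemma additive_expo: "additive X (expo x)"
  by (simp add: additive_def)

lemma additive_Nil:
  assumes "additive X f"
  shows "f [] = 0"
proof -
  have "f (reduce ([] @ [])) = f [] + f []"
    using assms reduced_words_Nil unfolding additive_def by blast
  then show ?thesis by (simp add: reduce_def)
qed

lemma additive_winv:
  assumes "additive X f" "w \<in> reduced_words X"
  shows "f (winv w) = - f w"
proof -
  have "f (reduce (winv w @ w)) = f (winv w) + f w"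
    using assms winv_in_reduced_words unfolding additive_def by blast
  then show ?thesis using additive_Nil[OF assms(1)] by simp
qed

lemma additive_rank_2:
  fixes f :: "nat word \<Rightarrow> int"
  assumes "additive {..<2} f" "w \<in> reduced_words {..<2}"
  shows "f w = expo 0 w * f [(0, False)] + expo 1 w * f [(1, False)]"
  using assms(2)
proof (induction w)
  case Nil
  then show ?case using additive_Nil[OF assms(1)] by simp
next
  case (Cons l w)
  obtain x b where l: "l = (x, b)" by force
  have w: "w \<in> reduced_words {..<2}" and x: "x = 0 \<or> x = 1"
    using Cons.prems l by (auto simp: reduced_words_Cons)
  have gen: "[(x, c)] \<in> reduced_words {..<2}" for c using x by (auto simp: reduced_words_Cons)
  have "f [(x, True)] = - f [(x, False)]"
    using additive_winv[OF assms(1) gen[of False]] by simp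
  then have "f [(x, b)] = (if b then - 1 else 1) * f [(x, False)]" by (cases b) simp_all
  moreover have "f (l # w) = f [l] + f w"
    using assms(1) gen w reduce_id[OF Cons.prems] l unfolding additive_def by (metis append_Cons append_Nil)
  ultimately show ?case using Cons.IH[OF w] x l by (auto simp: algebra_simps)
qed

lemma additive_eq_0_on_generate:
  assumes "additive X f" "B \<subseteq> reduced_words X" "\<And>b. b \<in> B \<Longrightarrow> f b = 0"
    and "w \<in> generate (free_group X) B"
  shows "f w = 0"
  using assms(4)
proof induction
  case one
  then show ?case using additive_Nil[OF assms(1)] by simp
next
  case (incl b)
  then show ?case using assms(3) by simp
next
  case (inv b)
  then have b: "b \<in> reduced_words X" using assms(2) by blast
  then show ?case using additive_winv[OF assms(1) b] assms(3) inv by (simp add: inv_free_group)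
next
  case (eng u v)
  have "u \<in> reduced_words X" "v \<in> reduced_words X"
    using group.generate_incl[OF group_free_group, of B X] assms(2) eng(1,2) by auto
  then show ?case using eng assms(1) by (simp add: additive_def)
qed

section \<open>Primitive elements of the free group of rank two\<close>

abbreviation gen_x :: "nat word" where "gen_x \<equiv> [(0, False)]"
abbreviation gen_y :: "nat word" where "gen_y \<equiv> [(1, False)]"

lemma gen_xy_carrier: "gen_x \<in> reduced_words {..<2}" "gen_y \<in> reduced_words {..<2}"
  by (simp_all add: reduced_words_Cons)

text \<open>
  A single word \<open>v\<close> does not generate: the determinant of the exponent sums of \<open>w\<close> and \<open>v\<close> vanishes
  identically in \<open>w\<close>, which forces the exponent sums of \<open>v\<close> to be zero.
\<close>

lemma generating_pair_nonempty:
  assumes "u \<in> reduced_words {..<2}" "v \<in> reduced_words {..<2}"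
    and gen: "generate (F 2) {u, v} = reduced_words {..<2}"
  shows "u \<noteq> []"
proof
  assume u: "u = []"
  have zero: "f w = 0" if "additive {..<2} f" "f v = 0" "w \<in> reduced_words {..<2}" for f w
    using additive_eq_0_on_generate[of "{..<2}" f "{u, v}" w] that assms additive_Nil[OF that(1)] u
    by (auto simp: F_def)
  let ?f = "\<lambda>w. expo 0 w * expo 1 v - expo 1 w * expo 0 v"
  have add: "additive {..<2} ?f" by (simp add: additive_def algebra_simps)
  have "?f gen_x = 0" "?f gen_y = 0"
    by (rule zero[OF add], simp, simp add: reduced_words_Cons)+
  then have "expo 0 v = 0" by simp
  then have "expo 0 gen_x = 0"
    by (rule zero[OF additive_expo _ gen_xy_carrier(1)])
  then show False by simp
qed

text \<open>
  By induction on the total length the pair may be assumed minimal. Then each of \<open>x\<close> and \<open>y\<close>, being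
  a word of length one in the subgroup generated, is one of the words of the pair up to inversion.
\<close>

theorem generating_pair_nielsen:
  assumes "u \<in> reduced_words {..<2}" "v \<in> reduced_words {..<2}"
    and "generate (F 2) {u, v} = reduced_words {..<2}"
  shows "nielsen (F 2) gen_x gen_y u v"
  using assms
proof (induction "length u + length v" arbitrary: u v rule: less_induct)
  case less
  interpret group "F 2" unfolding F_def by (rule group_free_group)
  have carrier: "carrier (F 2) = reduced_words {..<2}" by (simp add: F_def)
  show ?case
  proof (cases "\<exists>u' v'. nielsen (F 2) u v u' v' \<and> length u' + length v' < length u + length v")
    case True
    then obtain u' v' where n: "nielsen (F 2) u v u' v'" and l: "length u' + length v' < length u + length v"
      by blast
    have c: "u' \<in> reduced_words {..<2}" "v' \<in> reduced_words {..<2}"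
      using nielsen_closed[OF n] less.prems carrier by auto
    have "generate (F 2) {u', v'} = reduced_words {..<2}"
      using nielsen_generate[OF n] less.prems carrier by simp
    then have "nielsen (F 2) gen_x gen_y u' v'" by (rule less.hyps[OF l c])
    moreover have "nielsen (F 2) u' v' u v" using nielsen_sym[OF n] less.prems carrier by simp
    ultimately show ?thesis using nielsen_trans by blast
  next
    case False
    have "v \<noteq> []" using generating_pair_nonempty[of v u] less.prems by (simp add: insert_commute)
    then interpret minimal_pair "{..<2}" u v
      using generating_pair_nonempty[OF less.prems] less.prems False
      by unfold_locales (auto simp: F_def not_less)
    have S: "[(x, False)] \<in> signed" if "x < 2" for x
      using letter_in_signed[of "(x, False)"] less.prems(3) that by (simp add: F_def reduced_words_Cons)
    have inv_xy: "inv\<^bsub>F 2\<^esub> gen_x = [(0, True)]" "inv\<^bsub>F 2\<^esub> gen_y = [(1, True)]"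
      using inv_free_group[OF gen_xy_carrier(1)] inv_free_group[OF gen_xy_carrier(2)] by (simp_all add: F_def)
    have signed_D: "u = w \<or> u = winv w \<or> v = w \<or> v = winv w" if "w \<in> signed" for w
      using that by (auto simp: signed_def)
    have "u \<in> {gen_x, inv\<^bsub>F 2\<^esub> gen_x} \<and> v \<in> {gen_y, inv\<^bsub>F 2\<^esub> gen_y} \<or>
        v \<in> {gen_x, inv\<^bsub>F 2\<^esub> gen_x} \<and> u \<in> {gen_y, inv\<^bsub>F 2\<^esub> gen_y}"
      using signed_D[OF S[of 0]] signed_D[OF S[of 1]] unfolding inv_xy by auto
    moreover have "nielsen (F 2) gen_x gen_y a b"
      if "a \<in> {gen_x, inv\<^bsub>F 2\<^esub> gen_x}" "b \<in> {gen_y, inv\<^bsub>F 2\<^esub> gen_y}" for a b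
      using that nielsen.refl[of "F 2" gen_x gen_y] nielsen.inv[of "F 2" gen_x gen_y gen_x]
        nielsen_inv_right[of gen_x gen_y _ gen_y] by auto
    ultimately show ?thesis using nielsen.swap[of "F 2" gen_x gen_y v u] by metis
  qed
qed

text \<open>
  A free basis admits dual homomorphisms to the integers: transport the exponent sum at \<open>b\<close> from
  the free group on \<open>B\<close>.
\<close>

lemma free_basis_dual:
  assumes "free_basis (free_group X) B" "b \<in> B"
  obtains f where "additive X f" "\<And>c. c \<in> B \<Longrightarrow> f c = (if c = b then 1 else 0)"
proof -
  interpret group "free_group X" by (rule group_free_group)
  let ?e = "eval_word (free_group X)"
  have iso: "?e \<in> iso (free_group B) (free_group X)" by (rule free_basis_iso[OF assms(1)])
  define h where "h = inv_into (reduced_words B) ?e"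
  have "h \<in> iso (free_group X) (free_group B)"
    using group.iso_set_sym[OF group_free_group iso] by (simp add: h_def)
  then have hom: "h \<in> hom (free_group X) (free_group B)" by (simp add: iso_def)
  have "h (reduce (u @ v)) = reduce (h u @ h v)"
    if "u \<in> reduced_words X" "v \<in> reduced_words X" for u v
    using hom_mult[OF hom] that by simp
  then have 1: "additive X (expo b \<circ> h)" by (simp add: additive_def)
  have 2: "(expo b \<circ> h) c = (if c = b then 1 else 0)" if "c \<in> B" for c
  proof -
    have c: "c \<in> reduced_words X" using that assms(1) by (auto simp: free_basis_def)
    have "?e [(c, False)] = c" using lift_generator[of id c] c by (simp add: eval_word_eq_lift)
    moreover have "[(c, False)] \<in> reduced_words B" using that by (simp add: reduced_words_Cons)
    moreover have "inj_on ?e (reduced_words B)" using iso by (simp add: iso_def bij_betw_def)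
    ultimately have "h c = [(c, False)]" unfolding h_def by (metis inv_into_f_f)
    then show ?thesis by simp
  qed
  show ?thesis using that[OF 1 2] by blast
qed

lemma free_basis_card_le_2:
  assumes "free_basis (F 2) B" "b1 \<in> B" "b2 \<in> B" "b3 \<in> B"
  shows "b1 = b2 \<or> b1 = b3 \<or> b2 = b3"
proof (rule ccontr)
  assume ne: "\<not> ?thesis"
  have B: "free_basis (free_group {..<2}) B" using assms(1) by (simp add: F_def)
  have mem: "b1 \<in> reduced_words {..<2}" "b2 \<in> reduced_words {..<2}" "b3 \<in> reduced_words {..<2}"
    using B assms by (auto simp: free_basis_def)
  obtain f1 where f1: "additive {..<2} f1" "\<And>c. c \<in> B \<Longrightarrow> f1 c = (if c = b1 then 1 else 0)"
    using free_basis_dual[OF B assms(2)] by blast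
  obtain f2 where f2: "additive {..<2} f2" "\<And>c. c \<in> B \<Longrightarrow> f2 c = (if c = b2 then 1 else 0)"
    using free_basis_dual[OF B assms(3)] by blast
  obtain f3 where f3: "additive {..<2} f3" "\<And>c. c \<in> B \<Longrightarrow> f3 c = (if c = b3 then 1 else 0)"
    using free_basis_dual[OF B assms(4)] by blast
  \<comment> \<open>The identity matrix of size three becomes a product of a \<open>3 \<times> 2\<close> and a \<open>2 \<times> 3\<close> matrix.\<close>
  define s1 t1 s2 t2 s3 t3 where st: "s1 = f1 gen_x" "t1 = f1 gen_y" "s2 = f2 gen_x" "t2 = f2 gen_y"
    "s3 = f3 gen_x" "t3 = f3 gen_y"
  define p1 q1 p2 q2 p3 q3 where pq: "p1 = expo 0 b1" "q1 = expo 1 b1" "p2 = expo 0 b2" "q2 = expo 1 b2"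
    "p3 = expo 0 b3" "q3 = expo 1 b3"
  have eqs: "p1 * s1 + q1 * t1 = 1" "p2 * s1 + q2 * t1 = 0" "p3 * s1 + q3 * t1 = 0"
      "p1 * s2 + q1 * t2 = 0" "p2 * s2 + q2 * t2 = 1" "p3 * s2 + q3 * t2 = 0"
      "p3 * s3 + q3 * t3 = 1"
    using additive_rank_2[OF f1(1) mem(1)] additive_rank_2[OF f1(1) mem(2)] additive_rank_2[OF f1(1) mem(3)]
      additive_rank_2[OF f2(1) mem(1)] additive_rank_2[OF f2(1) mem(2)] additive_rank_2[OF f2(1) mem(3)]
      additive_rank_2[OF f3(1) mem(3)] f1(2) f2(2) f3(2) assms(2-4) ne
    by (auto simp: st pq)
  have "(p1 * q2 - p2 * q1) * (s1 * t2 - s2 * t1) =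
      (p1 * s1 + q1 * t1) * (p2 * s2 + q2 * t2) - (p2 * s1 + q2 * t1) * (p1 * s2 + q1 * t2)"
    by (simp add: algebra_simps)
  then have det: "s1 * t2 - s2 * t1 \<noteq> 0" using eqs by auto
  \<comment> \<open>Cramer's rule for the homogeneous system that the dual functions of \<open>b1\<close> and \<open>b2\<close> impose on \<open>b3\<close>.\<close>
  have "p3 * (s1 * t2 - s2 * t1) = (p3 * s1 + q3 * t1) * t2 - (p3 * s2 + q3 * t2) * t1"
    "q3 * (s1 * t2 - s2 * t1) = (p3 * s2 + q3 * t2) * s1 - (p3 * s1 + q3 * t1) * s2"
    by (simp_all add: algebra_simps)
  then have "p3 = 0" "q3 = 0" using eqs det by auto
  then show False using eqs by simp
qed

lemma primitive_nielsen:
  assumes "primitive (F 2) w"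
  obtains v where "v \<in> reduced_words {..<2}" "nielsen (F 2) gen_x gen_y w v"
proof -
  obtain B where B: "free_basis (F 2) B" "w \<in> B" using assms by (auto simp: primitive_def)
  have "\<exists>v \<in> B. B = {w, v}"
  proof (cases "B = {w}")
    case False
    then obtain v where v: "v \<in> B" "v \<noteq> w" using B(2) by blast
    then have "B = {w, v}" using free_basis_card_le_2[OF B(1,2) v(1)] B(2) by blast
    then show ?thesis using v by blast
  qed simp
  then obtain v where v: "v \<in> B" "B = {w, v}" by blast
  have "w \<in> reduced_words {..<2}" "v \<in> reduced_words {..<2}" "generate (F 2) {w, v} = reduced_words {..<2}"
    using B v by (auto simp: free_basis_def F_def)
  then show ?thesis using that generating_pair_nielsen by blast
qed

section \<open>Cyclically reduced primitive words\<close>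

lemma (in group) christoffel_type_components:
  assumes "christoffel_type G x y u v" "x \<in> carrier G" "y \<in> carrier G"
  shows "\<exists>p q U V A g. p \<in> {x, inv x} \<and> q \<in> {y, inv y} \<and> christoffel G p q U V \<and>
    g \<in> carrier G \<and> A \<in> {U, V, inv U, inv V} \<and> u = g \<otimes> A \<otimes> inv g" (is "?P u")
proof -
  have "?P u \<and> ?P v"
    using assms(1)
  proof induction
    case (base p q U V)
    then have "p \<in> carrier G" "q \<in> carrier G" using assms by auto
    then have "U \<in> carrier G" "V \<in> carrier G" using christoffel_closed[OF base(3)] by auto
    then have UV: "U = \<one> \<otimes> U \<otimes> inv \<one>" "V = \<one> \<otimes> V \<otimes> inv \<one>" by simp_all
    show ?case using base UV one_closed by blast
  next
    case (swap u v)
    then show ?case by blast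
  next
    case (inv u v)
    then obtain p q U V A g where *: "p \<in> {x, inv x}" "q \<in> {y, inv y}" "christoffel G p q U V"
      "g \<in> carrier G" "A \<in> {U, V, inv U, inv V}" "u = g \<otimes> A \<otimes> inv g" by blast
    have "p \<in> carrier G" "q \<in> carrier G" using assms * by auto
    then have UV: "U \<in> carrier G" "V \<in> carrier G" using christoffel_closed[OF *(3)] by auto
    then have "A \<in> carrier G" using * by auto
    then have "inv u = g \<otimes> inv A \<otimes> inv g" using * by (simp add: m_assoc inv_mult_group)
    moreover have "inv A \<in> {U, V, inv U, inv V}" using *(5) UV by auto
    ultimately have "?P (inv u)" using *(1-4) by blast
    then show ?case using inv.IH by blast
  next
    case (conj u v h)
    have step: "?P (h \<otimes> w \<otimes> inv h)" if w: "?P w" for w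
    proof -
      obtain p q U V A g where *: "p \<in> {x, inv x}" "q \<in> {y, inv y}" "christoffel G p q U V"
        "g \<in> carrier G" "A \<in> {U, V, inv U, inv V}" "w = g \<otimes> A \<otimes> inv g" using w by blast
      have "p \<in> carrier G" "q \<in> carrier G" using assms * by auto
      then have UV: "U \<in> carrier G" "V \<in> carrier G" using christoffel_closed[OF *(3)] by auto
      then have "A \<in> carrier G" using * by auto
      then have "h \<otimes> w \<otimes> inv h = (h \<otimes> g) \<otimes> A \<otimes> inv (h \<otimes> g)"
        using * conj.hyps by (simp add: m_assoc inv_mult_group)
      moreover have "h \<otimes> g \<in> carrier G" using * conj.hyps by simp
      ultimately show ?thesis using *(1-3,5) by blast
    qed
    show ?case
      by (intro conjI step[OF conj.IH[THEN conjunct1]] step[OF conj.IH[THEN conjunct2]])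
  qed
  then show ?thesis by (rule conjunct1)
qed

text \<open>
  Each of the two generators occurs with a fixed sign only; \<open>b\<close> and \<open>c\<close> are the signs.
\<close>

definition positive :: "bool \<Rightarrow> bool \<Rightarrow> nat word \<Rightarrow> bool" where
  "positive b c w \<longleftrightarrow> set w \<subseteq> {(0, b), (1, c)}"

lemma positive_append [simp]: "positive b c (u @ v) \<longleftrightarrow> positive b c u \<and> positive b c v"
  by (auto simp: positive_def)

lemma positive_winv: "positive b c w \<Longrightarrow> positive (\<not> b) (\<not> c) (winv w)"
  by (induction w) (auto simp: positive_def)

lemma positive_reduced: "positive b c w \<Longrightarrow> reduced w"
proof (induction w)
  case (Cons l w)
  then have "hd w \<in> {(0, b), (1, c)}" if "w \<noteq> []" using that by (cases w) (auto simp: positive_def)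
  with Cons show ?case by (auto simp: reduced_Cons positive_def)
qed simp

lemma positive_cyclically_reduced: "positive b c w \<Longrightarrow> cyclically_reduced w"
  unfolding cyclically_reduced_iff by (rule positive_reduced[of b c]) simp

lemma length_positive:
  assumes "positive b c w"
  shows "int (length w) = \<bar>expo 0 w\<bar> + \<bar>expo 1 w\<bar>"
proof -
  let ?s = "\<lambda>b :: bool. if b then - 1 else 1 :: int"
  have "?s b * expo 0 w \<ge> 0 \<and> ?s c * expo 1 w \<ge> 0 \<and> int (length w) = ?s b * expo 0 w + ?s c * expo 1 w"
    using assms by (induction w) (auto simp: positive_def)
  then show ?thesis by (cases b; cases c) auto
qed

lemma christoffel_positive:
  assumes "christoffel (F 2) [(0, b)] [(1, c)] U V"
  shows "positive b c U \<and> U \<noteq> [] \<and> positive b c V \<and> V \<noteq> []"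
  using assms
proof induction
  case base
  then show ?case by (simp add: positive_def)
next
  case (left U V)
  then have "reduce (U @ V) = U @ V" by (intro reduce_reduced positive_reduced[of b c]) simp
  with left show ?case by (simp add: F_def)
next
  case (right U V)
  then have "reduce (U @ V) = U @ V" by (intro reduce_reduced positive_reduced[of b c]) simp
  with right show ?case by (simp add: F_def)
qed

text \<open>
  Up to conjugation a primitive element is a component of a Christoffel pair or the inverse of one.
  Such a word is cyclically reduced, so any cyclically reduced conjugate is one of its rotations.
\<close>

theorem cyclically_reduced_primitive_positive:
  assumes "primitive (F 2) w" "cyclically_reduced w"
  obtains b c where "positive b c w"
proof -
  interpret group "F 2" unfolding F_def by (rule group_free_group)
  have carrier: "carrier (F 2) = reduced_words {..<2}" by (simp add: F_def)
  obtain v where "nielsen (F 2) gen_x gen_y w v" using primitive_nielsen[OF assms(1)] by blast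
  then have "christoffel_type (F 2) gen_x gen_y w v"
    using nielsen_imp_christoffel_type gen_xy_carrier carrier by simp
  then obtain p q U V A g where *: "p \<in> {gen_x, inv\<^bsub>F 2\<^esub> gen_x}" "q \<in> {gen_y, inv\<^bsub>F 2\<^esub> gen_y}"
      "christoffel (F 2) p q U V" "g \<in> carrier (F 2)"
      "A \<in> {U, V, inv\<^bsub>F 2\<^esub> U, inv\<^bsub>F 2\<^esub> V}" "w = g \<otimes>\<^bsub>F 2\<^esub> A \<otimes>\<^bsub>F 2\<^esub> inv\<^bsub>F 2\<^esub> g"
    using christoffel_type_components gen_xy_carrier carrier by metis
  have inv_xy: "inv\<^bsub>F 2\<^esub> gen_x = [(0, True)]" "inv\<^bsub>F 2\<^esub> gen_y = [(1, True)]"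
    using inv_free_group[OF gen_xy_carrier(1)] inv_free_group[OF gen_xy_carrier(2)] by (simp_all add: F_def)
  obtain b c where pq: "p = [(0, b)]" "q = [(1, c)]" using *(1,2) unfolding inv_xy by auto
  have "p \<in> carrier (F 2)" "q \<in> carrier (F 2)" using pq carrier by (simp_all add: reduced_words_Cons)
  then have UV: "U \<in> reduced_words {..<2}" "V \<in> reduced_words {..<2}"
    using christoffel_closed[OF *(3)] carrier by auto
  have pos: "positive b c U" "U \<noteq> []" "positive b c V" "V \<noteq> []"
    using christoffel_positive *(3) pq by auto
  have "A \<in> {U, V, winv U, winv V}" using *(5) UV by (simp add: F_def inv_free_group)
  then obtain b' c' where A: "positive b' c' A" "A \<noteq> []"
    using pos positive_winv by (metis insertE singletonD winv_eq_Nil_iff)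
  have "reduced g" using *(4) carrier by (simp add: reduced_words_iff)
  moreover have "w = reduce (g @ A @ winv g)" using *(4,6) carrier by (simp add: F_def inv_free_group)
  ultimately obtain k where "w = rotate k A"
    using cyclically_reduced_conjugates[OF positive_cyclically_reduced[OF A(1)] A(2)] assms(2) by auto
  then have "positive b' c' w" using A(1) by (simp add: positive_def)
  then show ?thesis using that by blast
qed

lemma length_cyclically_reduced_primitive:
  assumes "primitive (F 2) w" "cyclically_reduced w"
  shows "int (length w) = \<bar>expo 0 w\<bar> + \<bar>expo 1 w\<bar>"
  using cyclically_reduced_primitive_positive[OF assms] length_positive by metis

text \<open>
  Nielsen moves change the determinant of the two rows of exponent sums at most by sign, and it is
  \<open>1\<close> for \<open>(x, y)\<close>.
\<close>

lemma primitive_coprime_expo: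
  assumes "primitive (F 2) w"
  shows "coprime (expo 0 w) (expo 1 w)"
proof -
  interpret group "F 2" unfolding F_def by (rule group_free_group)
  have carrier: "carrier (F 2) = reduced_words {..<2}" by (simp add: F_def)
  obtain v where n: "nielsen (F 2) gen_x gen_y w v" using primitive_nielsen[OF assms(1)] by blast
  then have "\<bar>expo 0 w * expo 1 v - expo 1 w * expo 0 v\<bar> = 1"
  proof induction
    case (inv u v)
    then have "u \<in> carrier (F 2)" using nielsen_closed[OF inv(1)] gen_xy_carrier carrier by auto
    then have "inv\<^bsub>F 2\<^esub> u = winv u" by (simp add: F_def inv_free_group)
    then show ?case using inv.IH by simp
  next
    case (mult u v)
    then show ?case by (simp add: F_def algebra_simps)
  next
    case (conj u v g)
    then have "inv\<^bsub>F 2\<^esub> g = winv g" by (simp add: F_def inv_free_group)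
    then show ?case using conj.IH by (simp add: F_def)
  qed (auto simp: mult.commute)
  then have "is_unit (expo 0 w * expo 1 v - expo 1 w * expo 0 v)" by simp
  then show ?thesis
    by (intro coprimeI) (meson dvd_diff dvd_mult2 dvd_trans)
qed

section \<open>Elementary automorphisms\<close>

definition flip_map :: "'a \<Rightarrow> 'a \<Rightarrow> 'a word" where
  "flip_map i = (\<lambda>k. [(k, False)])(i := [(i, True)])"

definition transvection_map :: "'a \<Rightarrow> 'a \<Rightarrow> bool \<Rightarrow> 'a \<Rightarrow> 'a word" where
  "transvection_map i j b = (\<lambda>k. [(k, False)])(i := [(i, False), (j, b)])"

lemma letter_in_reduced_words: "[l] \<in> reduced_words X \<longleftrightarrow> fst l \<in> X"
  by (simp add: reduced_words_Cons)

lemma flip_iso: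
  assumes "i \<in> X"
  shows "lift (free_group X) (flip_map i) \<in> iso (free_group X) (free_group X)"
proof (rule lift_iso[where f' = "flip_map i"])
  have id: "lift (free_group X) (flip_map i) (flip_map i x) = [(x, False)]" if "x \<in> X" for x
    using that assms
    by (cases "x = i"; simp add: flip_map_def lift_Cons inv_free_group letter_in_reduced_words reduce_def)
  show "lift (free_group X) (flip_map i) (flip_map i x) = [(x, False)]"
    "lift (free_group X) (flip_map i) (flip_map i x) = [(x, False)]" if "x \<in> X" for x
    by (rule id[OF that])+
qed (use assms in \<open>auto simp: flip_map_def letter_in_reduced_words\<close>)

lemma transvection_iso:
  assumes "i \<in> X" "j \<in> X" "i \<noteq> j"
  shows "lift (free_group X) (transvection_map i j b) \<in> iso (free_group X) (free_group X)"
proof (rule lift_iso[where f' = "transvection_map i j (\<not> b)"])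
  have "lift (free_group X) (transvection_map i j b) (transvection_map i j (\<not> b) x) = [(x, False)]"
    if "x \<in> X" for x b
    using that assms
    by (cases "x = i"; cases b; simp add: transvection_map_def lift_Cons inv_free_group letter_in_reduced_words reduce_def)
  from this this[of _ "\<not> b"]
  show "lift (free_group X) (transvection_map i j b) (transvection_map i j (\<not> b) x) = [(x, False)]"
    "lift (free_group X) (transvection_map i j (\<not> b)) (transvection_map i j b x) = [(x, False)]"
    if "x \<in> X" for x using that by simp_all
qed (use assms in \<open>auto simp: transvection_map_def letter_in_reduced_words reduced_words_Cons\<close>)

lemma expo_automorphism:
  assumes "\<phi> \<in> iso (F 2) (F 2)" "w \<in> reduced_words {..<2}"
  shows "expo i (\<phi> w) = expo 0 w * expo i (\<phi> gen_x) + expo 1 w * expo i (\<phi> gen_y)"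
proof -
  have "\<phi> \<in> hom (free_group {..<2}) (free_group {..<2})" using assms(1) by (simp add: iso_def F_def)
  then have "additive {..<2} (expo i \<circ> \<phi>)"
    by (simp add: hom_def additive_def)
  from additive_rank_2[OF this assms(2)] show ?thesis by simp
qed

text \<open>
  The pairs of exponent sums of images of \<open>x\<close> under automorphisms.
\<close>

definition attained :: "int \<Rightarrow> int \<Rightarrow> bool" where
  "attained a b \<longleftrightarrow> (\<exists>\<phi> \<in> iso (F 2) (F 2). expo 0 (\<phi> gen_x) = a \<and> expo 1 (\<phi> gen_x) = b)"

lemma attained_compose:
  assumes "attained a b" "\<tau> \<in> iso (F 2) (F 2)"
  shows "attained (a * expo 0 (\<tau> gen_x) + b * expo 0 (\<tau> gen_y)) (a * expo 1 (\<tau> gen_x) + b * expo 1 (\<tau> gen_y))"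
proof -
  obtain \<phi> where \<phi>: "\<phi> \<in> iso (F 2) (F 2)" "expo 0 (\<phi> gen_x) = a" "expo 1 (\<phi> gen_x) = b"
    using assms(1) unfolding attained_def by blast
  have "\<tau> \<circ> \<phi> \<in> iso (F 2) (F 2)" by (rule iso_set_trans[OF \<phi>(1) assms(2)])
  moreover have "\<phi> gen_x \<in> reduced_words {..<2}"
    using \<phi>(1) gen_xy_carrier by (auto simp: iso_def hom_def F_def)
  ultimately show ?thesis
    unfolding attained_def using expo_automorphism[OF assms(2)] \<phi> by (intro bexI[of _ "\<tau> \<circ> \<phi>"]) auto
qed

lemma attained_moves:
  assumes "attained a b"
  shows "attained (- a) b" "attained a (- b)" "attained (a + b) b" "attained a (a + b)"
proof -
  have lift: "lift (F 2) f [(x, False)] = f x" if "x < 2" "f x \<in> reduced_words {..<2}" for f x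
    using that group.lift_generator[OF group_free_group, of f x "{..<2}"] by (simp add: F_def)
  show "attained (- a) b"
    using attained_compose[OF assms flip_iso[of "0::nat" "{..<2}", folded F_def]]
    by (simp add: lift flip_map_def letter_in_reduced_words)
  show "attained a (- b)"
    using attained_compose[OF assms flip_iso[of "1::nat" "{..<2}", folded F_def]]
    by (simp add: lift flip_map_def letter_in_reduced_words)
  show "attained (a + b) b"
    using attained_compose[OF assms transvection_iso[of "1::nat" "{..<2}" 0 False, folded F_def]]
    by (simp add: lift transvection_map_def reduced_words_Cons add.commute)
  show "attained a (a + b)"
    using attained_compose[OF assms transvection_iso[of "0::nat" "{..<2}" 1 False, folded F_def]]
    by (simp add: lift transvection_map_def reduced_words_Cons add.commute)
qed

text \<open>
  The Euclidean algorithm, run by transvections.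
\<close>

lemma attained_nat: "coprime a b \<Longrightarrow> attained (int a) (int b)"
proof (induction "a + b" arbitrary: a b rule: less_induct)
  case less
  have "(\<lambda>w. w) \<in> iso (F 2) (F 2)" using iso_set_refl by blast
  then have 10: "attained 1 0" unfolding attained_def by force
  \<comment> \<open>The moves lead from \<open>(1, 0)\<close> through \<open>(1, 1)\<close> and \<open>(-1, 1)\<close> to \<open>(0, 1)\<close>.\<close>
  then have 01: "attained 0 1"
    using attained_moves(3)[OF attained_moves(1)[OF attained_moves(4)[OF 10]]] by simp
  consider "a = 0" | "b = 0" | "0 < b" "b \<le> a" | "0 < a" "a \<le> b" by linarith
  then show ?case
  proof cases
    case 3
    then have "coprime (a - b) b"
      using less.prems gcd_diff1_nat[of b a] by (simp add: coprime_iff_gcd_eq_1)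
    then have "attained (int (a - b)) (int b)" using less.hyps[of "a - b" b] 3 by simp
    then show ?thesis using attained_moves(3)[of "int (a - b)" "int b"] 3 by (simp add: of_nat_diff)
  next
    case 4
    then have "coprime a (b - a)"
      using less.prems gcd_diff1_nat[of a b] by (simp add: coprime_iff_gcd_eq_1 gcd.commute)
    then have "attained (int a) (int (b - a))" using less.hyps[of a "b - a"] 4 by simp
    then show ?thesis using attained_moves(4)[of "int a" "int (b - a)"] 4 by (simp add: of_nat_diff)
  qed (use less.prems 10 01 in auto)
qed

lemma coprime_attained:
  assumes "coprime a b"
  shows "attained a b"
proof -
  have "coprime (nat \<bar>a\<bar>) (nat \<bar>b\<bar>)" using assms by simp
  then have *: "attained \<bar>a\<bar> \<bar>b\<bar>" using attained_nat by fastforce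
  show ?thesis
    using * attained_moves(1)[OF *] attained_moves(2)[OF *] attained_moves(2)[OF attained_moves(1)[OF *]]
    by (cases "a \<ge> 0"; cases "b \<ge> 0") auto
qed

section \<open>Conjugacy of primitive elements with equal exponent sums\<close>

lemma primitive_cyclic_reduction:
  assumes "primitive (free_group X) w"
  obtains g c where "g \<in> reduced_words X" "c \<in> reduced_words X" "w = g @ c @ winv g"
    "cyclically_reduced c" "primitive (free_group X) c"
proof -
  have w: "w \<in> reduced_words X" using primitive_in_carrier[OF assms] by simp
  then have "reduced w" by (simp add: reduced_words_iff)
  then obtain g c where *: "w = g @ c @ winv g" "cyclically_reduced c" by (rule cyclic_reduction)
  have gc: "g \<in> reduced_words X" "c \<in> reduced_words X"
    using w * by (auto simp: reduced_words_iff reduced_append)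
  have "reduce (winv g @ w @ winv (winv g)) = reduce c"
    using reduce_cancel_winv[of "[]" g "c @ winv g @ g"] reduce_cancel_winv[of c g "[]"] * by simp
  also have "\<dots> = c" by (rule reduce_id[OF gc(2)])
  finally have "primitive (free_group X) c"
    using primitive_conjugate[OF assms winv_in_reduced_words[OF gc(1)]] by simp
  then show ?thesis using that gc * by blast
qed

text \<open>
  The cyclically reduced form has length \<open>1 + 0\<close>, so it is a single letter.
\<close>

lemma primitive_expo_1_0:
  assumes "primitive (F 2) w" "expo 0 w = 1" "expo 1 w = 0"
  obtains g where "g \<in> reduced_words {..<2}" "w = reduce (g @ gen_x @ winv g)"
proof -
  obtain g c where *: "g \<in> reduced_words {..<2}" "c \<in> reduced_words {..<2}" "w = g @ c @ winv g"
    "cyclically_reduced c" "primitive (F 2) c"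
    using primitive_cyclic_reduction assms(1) unfolding F_def by blast
  have e: "expo 0 c = 1" "expo 1 c = 0" using assms(2,3) *(3) by simp_all
  then have "length c = 1" using length_cyclically_reduced_primitive[OF *(5,4)] by simp
  then obtain x b where "c = [(x, b)]" by (metis One_nat_def length_0_conv length_Suc_conv surj_pair)
  then have "c = gen_x" using e by (auto split: if_splits)
  moreover have "reduce w = w" using primitive_in_carrier[OF assms(1)] by (simp add: F_def reduce_id)
  ultimately show ?thesis using that *(1,3) by simp
qed

text \<open>
  Both words are compared with \<open>\<phi> x\<close>, where \<open>\<phi>\<close> is an automorphism for which \<open>\<phi> x\<close> has the given
  exponent sums: pulled back along \<open>\<phi>\<close> they have exponent sums \<open>(1, 0)\<close>, and the preceding lemma
  applies.
\<close>

theorem primitive_same_expo_conjugate: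
  assumes "primitive (F 2) w" "primitive (F 2) w'" "expo 0 w = expo 0 w'" "expo 1 w = expo 1 w'"
  shows "\<exists>g \<in> reduced_words {..<2}. w = reduce (g @ w' @ winv g)"
proof -
  interpret group "F 2" unfolding F_def by (rule group_free_group)
  have carrier: "carrier (F 2) = reduced_words {..<2}" by (simp add: F_def)
  obtain \<phi> where \<phi>: "\<phi> \<in> iso (F 2) (F 2)" "expo 0 (\<phi> gen_x) = expo 0 w" "expo 1 (\<phi> gen_x) = expo 1 w"
    using coprime_attained[OF primitive_coprime_expo[OF assms(1)]] unfolding attained_def by blast
  have \<phi>_mult: "\<phi> (reduce (a @ b)) = reduce (\<phi> a @ \<phi> b)"
    if "a \<in> reduced_words {..<2}" "b \<in> reduced_words {..<2}" for a b
    using \<phi>(1) that by (simp add: iso_def hom_def F_def)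
  have bij: "bij_betw \<phi> (reduced_words {..<2}) (reduced_words {..<2})"
    using \<phi>(1) by (simp add: iso_def carrier)
  define \<psi> where "\<psi> = inv_into (reduced_words {..<2}) \<phi>"
  have \<psi>: "\<psi> \<in> iso (F 2) (F 2)" using iso_set_sym[OF \<phi>(1)] by (simp add: \<psi>_def carrier)
  have conj: "\<exists>g \<in> reduced_words {..<2}. v = reduce (g @ \<phi> gen_x @ winv g)"
    if v: "primitive (F 2) v" "expo 0 v = expo 0 w" "expo 1 v = expo 1 w" for v
  proof -
    have vc: "v \<in> reduced_words {..<2}" using primitive_in_carrier[OF v(1)] carrier by simp
    have \<phi>x: "\<phi> gen_x \<in> reduced_words {..<2}" using bij gen_xy_carrier by (auto simp: bij_betw_def)
    have "expo i (\<psi> v) = expo i (\<psi> (\<phi> gen_x))" for i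
      using expo_automorphism[OF \<psi> vc, of i] expo_automorphism[OF \<psi> \<phi>x, of i] v \<phi> by simp
    moreover have "\<psi> (\<phi> gen_x) = gen_x"
      unfolding \<psi>_def using bij gen_xy_carrier by (intro inv_into_f_f) (auto simp: bij_betw_def)
    ultimately have "expo 0 (\<psi> v) = 1" "expo 1 (\<psi> v) = 0" by simp_all
    moreover have "primitive (F 2) (\<psi> v)" by (rule iso_primitive[OF is_group is_group \<psi> v(1)])
    ultimately obtain g where g: "g \<in> reduced_words {..<2}" "\<psi> v = reduce (g @ gen_x @ winv g)"
      using primitive_expo_1_0 by blast
    have wg: "winv g \<in> reduced_words {..<2}" by (rule winv_in_reduced_words[OF g(1)])
    have \<phi>_winv: "\<phi> (winv g) = winv (\<phi> g)"
    proof -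
      interpret \<phi>: group_hom "F 2" "F 2" \<phi>
        using \<phi>(1) by (simp add: group_hom_def group_hom_axioms_def iso_def is_group)
      show ?thesis using \<phi>.hom_inv[of g] g(1) \<phi>.hom_closed[of g] by (simp add: F_def inv_free_group)
    qed
    have \<phi>g: "\<phi> g \<in> reduced_words {..<2}" using bij g(1) by (auto simp: bij_betw_def)
    have xg: "reduce (gen_x @ winv g) \<in> reduced_words {..<2}"
      using m_closed[of gen_x "winv g"] gen_xy_carrier(1) wg by (simp add: F_def)
    have "v = \<phi> (\<psi> v)" unfolding \<psi>_def using bij vc by (simp add: bij_betw_def f_inv_into_f)
    also have "\<dots> = \<phi> (reduce (g @ reduce (gen_x @ winv g)))" using g(2) by simp
    also have "\<dots> = reduce (\<phi> g @ \<phi> (reduce (gen_x @ winv g)))" by (rule \<phi>_mult[OF g(1) xg])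
    also have "\<phi> (reduce (gen_x @ winv g)) = reduce (\<phi> gen_x @ \<phi> (winv g))"
      by (rule \<phi>_mult[OF gen_xy_carrier(1) wg])
    finally show ?thesis using \<phi>g \<phi>_winv by auto
  qed
  obtain g where g: "g \<in> reduced_words {..<2}" "w = reduce (g @ \<phi> gen_x @ winv g)"
    using conj[OF assms(1)] by blast
  obtain h where h: "h \<in> reduced_words {..<2}" "w' = reduce (h @ \<phi> gen_x @ winv h)"
    using conj[OF assms(2)] assms(3,4) by auto
  let ?k = "reduce (g @ winv h)"
  have k: "?k \<in> reduced_words {..<2}"
    using m_closed[of g "winv h"] g(1) winv_in_reduced_words[OF h(1)] by (simp add: F_def)
  have "winv ?k = reduce (h @ winv g)"
    using winv_product[of g "winv h"] g(1) h(1) by (simp add: reduced_words_iff)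
  then have "reduce (?k @ w' @ winv ?k) = reduce (g @ winv h @ reduce (h @ \<phi> gen_x @ winv h) @ h @ winv g)"
    using h(2) reduce_reduce_right[of "g @ winv h @ w'" "h @ winv g"] by simp
  also have "\<dots> = reduce (g @ winv h @ h @ \<phi> gen_x @ winv h @ h @ winv g)"
    using reduce_reduce_inner[of "g @ winv h" "h @ \<phi> gen_x @ winv h" "h @ winv g"] by simp
  also have "\<dots> = w"
    using reduce_cancel_winv[of g h "\<phi> gen_x @ winv h @ h @ winv g"]
      reduce_cancel_winv[of "g @ \<phi> gen_x" h "winv g"] g(2) by simp
  finally show ?thesis using k by metis
qed

section \<open>Counting cyclically reduced primitive words\<close>

text \<open>
  Two coinciding rotations give a factorisation of \<open>c\<close> into two nonempty commuting words. Commuting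
  words are powers of a common word, so both exponent sums share a factor greater than one.
\<close>

lemma rotations_distinct:
  assumes "coprime (expo x c) (expo y c)"
  shows "inj_on (\<lambda>k. rotate k c) {..<length c}"
proof (rule linorder_inj_onI')
  fix i j assume ij: "i \<in> {..<length c}" "j \<in> {..<length c}" "i < j"
  show "rotate i c \<noteq> rotate j c"
  proof
    assume eq: "rotate i c = rotate j c"
    define d where "d = j - i"
    have d: "0 < d" "d < length c" using ij by (auto simp: d_def)
    have "c = rotate (length c - i) (rotate i c)" using ij by (simp add: rotate_rotate)
    also have "\<dots> = rotate (length c - i + j) c" by (simp add: eq rotate_rotate)
    also have "length c - i + j = d + length c" using ij by (simp add: d_def)
    finally have "c = rotate d c" using rotate_conv_mod[of "d + length c" c] d by simp
    then have "take d c @ drop d c = drop d c @ take d c"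
      using d by (simp add: rotate_drop_take)
    then obtain p q zs where pq: "concat (replicate p zs) = take d c" "concat (replicate q zs) = drop d c"
      using comm_append_are_replicate by blast
    have "p \<noteq> 0" "q \<noteq> 0" using pq d by (auto intro!: Nat.gr0I)
    have power: "expo z (concat (replicate n zs)) = int n * expo z zs" for z n
      by (induction n) (auto simp: algebra_simps)
    have "c = concat (replicate p zs) @ concat (replicate q zs)" using pq by simp
    then have e: "expo z c = int (p + q) * expo z zs" for z
      by (metis power expo_append distrib_right of_nat_add)
    have "int (p + q) dvd expo x c" "int (p + q) dvd expo y c" unfolding e by simp_all
    then have "is_unit (int (p + q))" using assms coprime_common_divisor by blast
    then show False using \<open>p \<noteq> 0\<close> \<open>q \<noteq> 0\<close> by simp
  qed
qed

definition cyclic_primitives :: "int \<times> int \<Rightarrow> nat word set" where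
  "cyclic_primitives z =
     {w. primitive (F 2) w \<and> cyclically_reduced w \<and> (expo 0 w, expo 1 w) = z}"

lemma primitive_letter:
  assumes "i < n"
  shows "primitive (F n) [(i, b)]"
proof -
  have pos: "primitive (F n) [(i, False)]"
    using free_basis_standard[of "{..<n}"] assms unfolding primitive_def F_def by blast
  show ?thesis
  proof (cases b)
    case True
    have "lift (F n) (flip_map i) [(i, False)] = [(i, True)]"
      by (simp add: F_def lift_Cons flip_map_def reduce_def)
    then show ?thesis
      using iso_primitive[OF group_free_group group_free_group flip_iso[of i "{..<n}"], of "[(i, False)]"]
        pos assms True by (simp add: F_def)
  qed (use pos in simp)
qed

lemma primitive_rotate:
  assumes "primitive (free_group X) w" "cyclically_reduced w"
  shows "primitive (free_group X) (rotate k w)"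
proof -
  define t d where "t = take (k mod length w) w" and "d = drop (k mod length w) w"
  have w: "w = t @ d" "rotate k w = d @ t" by (simp_all add: t_def d_def rotate_drop_take)
  have wX: "w \<in> reduced_words X" using primitive_in_carrier[OF assms(1)] by simp
  then have t: "winv t \<in> reduced_words X"
    unfolding w(1) by (auto simp: reduced_words_iff reduced_append)
  have "reduced (d @ t)"
    using cyclically_reduced_rotate[OF assms(2), of k] w(2) by (simp add: cyclically_reduced_def)
  then have "reduce (winv t @ w @ winv (winv t)) = rotate k w"
    using reduce_cancel_winv[of "[]" t "d @ t"] w by (simp add: reduce_reduced)
  then show ?thesis using primitive_conjugate[OF assms(1) t] by simp
qed

lemma card_cyclic_primitives:
  assumes "coprime a b"
  shows "card (cyclic_primitives (a, b)) = nat (\<bar>a\<bar> + \<bar>b\<bar>)"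
proof -
  obtain \<phi> where \<phi>: "\<phi> \<in> iso (F 2) (F 2)" "expo 0 (\<phi> gen_x) = a" "expo 1 (\<phi> gen_x) = b"
    using coprime_attained[OF assms] unfolding attained_def by blast
  have "group (F 2)" unfolding F_def by (rule group_free_group)
  then have "primitive (F 2) (\<phi> gen_x)"
    using iso_primitive[OF _ _ \<phi>(1) primitive_letter] by simp
  then obtain g c where c: "\<phi> gen_x = g @ c @ winv g" "cyclically_reduced c" "primitive (F 2) c"
    using primitive_cyclic_reduction unfolding F_def by metis
  have e: "expo 0 c = a" "expo 1 c = b" using c(1) \<phi>(2,3) by simp_all
  have len: "length c = nat (\<bar>a\<bar> + \<bar>b\<bar>)"
    using length_cyclically_reduced_primitive[OF c(3,2)] e by simp
  have ne: "c \<noteq> []" using assms e by auto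
  have "cyclic_primitives (a, b) = (\<lambda>k. rotate k c) ` {..<length c}"
  proof
    show "cyclic_primitives (a, b) \<subseteq> (\<lambda>k. rotate k c) ` {..<length c}"
    proof
      fix w assume "w \<in> cyclic_primitives (a, b)"
      then have w: "primitive (F 2) w" "cyclically_reduced w" "expo 0 w = expo 0 c" "expo 1 w = expo 1 c"
        using e by (auto simp: cyclic_primitives_def)
      obtain h where "h \<in> reduced_words {..<2}" "w = reduce (h @ c @ winv h)"
        using primitive_same_expo_conjugate[OF w(1) c(3) w(3,4)] by blast
      then obtain k where "w = rotate k c"
        using cyclically_reduced_conjugates[OF c(2) ne] w(2) by (metis reduced_words_iff)
      then have "w = rotate (k mod length c) c" by (simp flip: rotate_conv_mod)
      then show "w \<in> (\<lambda>k. rotate k c) ` {..<length c}" using ne by simp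
    qed
    show "(\<lambda>k. rotate k c) ` {..<length c} \<subseteq> cyclic_primitives (a, b)"
      using primitive_rotate[of "{..<2}" c] c(2,3) cyclically_reduced_rotate e
      by (auto simp: cyclic_primitives_def F_def)
  qed
  then show ?thesis
    using rotations_distinct[of 0 c 1] assms e len by (simp add: card_image)
qed

text \<open>
  The predicate \<open>P\<close> selects a region of the plane.
\<close>

definition coprime_pairs :: "nat \<Rightarrow> (int \<Rightarrow> int \<Rightarrow> bool) \<Rightarrow> (int \<times> int) set" where
  "coprime_pairs m P = {(a, b). coprime a b \<and> \<bar>a\<bar> + \<bar>b\<bar> = int m \<and> P a b}"

lemma finite_coprime_pairs: "finite (coprime_pairs m P)"
proof (rule finite_subset)
  show "coprime_pairs m P \<subseteq> {- int m..int m} \<times> {- int m..int m}"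
    by (auto simp: coprime_pairs_def)
qed simp

lemma card_coprime_pairs_quarter_turn:
  "card (coprime_pairs m P) = card (coprime_pairs m (\<lambda>a b. P b (- a)))"
proof (rule bij_betw_same_card)
  show "bij_betw (\<lambda>(a, b). (- b, a)) (coprime_pairs m P) (coprime_pairs m (\<lambda>a b. P b (- a)))"
    by (rule bij_betwI[where g = "\<lambda>(a, b). (b, - a)"]) (auto simp: coprime_pairs_def coprime_commute)
qed

text \<open>
  The pairs of this quadrant are \<open>(k, m - k)\<close> with \<open>0 < k \<le> m\<close>. The half-open quadrant includes
  \<open>k = m\<close>, which counts precisely when \<open>m = 1\<close>.
\<close>

lemma card_coprime_pairs_quadrant:
  "card (coprime_pairs m (\<lambda>a b. 0 < a \<and> 0 \<le> b)) = totient m"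
proof -
  have coprime: "coprime (int k) (int m - int k) \<longleftrightarrow> coprime k m" for k
    using gcd_diff1[of "int m" "int k"]
    by (metis coprime_iff_gcd_eq_1 coprime_int_iff gcd.commute)
  have "coprime_pairs m (\<lambda>a b. 0 < a \<and> 0 \<le> b) = (\<lambda>k. (int k, int m - int k)) ` totatives m"
  proof (intro Set.set_eqI iffI)
    fix z assume "z \<in> coprime_pairs m (\<lambda>a b. 0 < a \<and> 0 \<le> b)"
    then obtain a b where z: "z = (a, b)" and ab: "coprime a b" "a + b = int m" "0 < a" "0 \<le> b"
      by (auto simp: coprime_pairs_def)
    have b: "b = int m - int (nat a)" "a = int (nat a)" using ab by auto
    then have "coprime (nat a) m" using ab(1) coprime[of "nat a"] by metis
    then have "nat a \<in> totatives m" using ab by (auto simp: totatives_def)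
    then show "z \<in> (\<lambda>k. (int k, int m - int k)) ` totatives m" using z b by blast
  qed (auto simp: coprime_pairs_def totatives_def coprime)
  moreover have "inj_on (\<lambda>k. (int k, int m - int k)) (totatives m)" by (auto simp: inj_on_def)
  ultimately show ?thesis by (simp add: card_image totient_def)
qed

lemma card_coprime_pairs_disj:
  assumes "\<And>a b. \<not> (P a b \<and> Q a b)"
  shows "card (coprime_pairs m (\<lambda>a b. P a b \<or> Q a b)) = card (coprime_pairs m P) + card (coprime_pairs m Q)"
proof -
  have "coprime_pairs m (\<lambda>a b. P a b \<or> Q a b) = coprime_pairs m P \<union> coprime_pairs m Q"
    unfolding coprime_pairs_def by blast
  moreover have "coprime_pairs m P \<inter> coprime_pairs m Q = {}"
    using assms unfolding coprime_pairs_def by blast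
  ultimately show ?thesis by (simp add: card_Un_disjoint finite_coprime_pairs)
qed

lemma card_coprime_pairs:
  assumes "m \<ge> 1"
  shows "card (coprime_pairs m (\<lambda>_ _. True)) = 4 * totient m"
proof -
  let ?Q = "coprime_pairs m"
  let ?P1 = "\<lambda>a b :: int. 0 < a \<and> 0 \<le> b" and ?P2 = "\<lambda>a b :: int. 0 < b \<and> 0 \<le> - a"
    and ?P3 = "\<lambda>a b :: int. 0 < - a \<and> 0 \<le> - b" and ?P4 = "\<lambda>a b :: int. 0 < - b \<and> 0 \<le> - (- a)"
  let ?P = "\<lambda>a b. ?P1 a b \<or> ?P2 a b \<or> ?P3 a b \<or> ?P4 a b"
  have "?P a b" if "\<bar>a\<bar> + \<bar>b\<bar> = int m" for a b using that assms by arith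
  then have all: "?Q (\<lambda>_ _. True) = ?Q ?P"
    unfolding coprime_pairs_def by blast
  have sum: "card (?Q ?P) = card (?Q ?P1) + (card (?Q ?P2) + (card (?Q ?P3) + card (?Q ?P4)))"
  proof -
    have "card (?Q ?P) = card (?Q ?P1) + card (?Q (\<lambda>a b. ?P2 a b \<or> ?P3 a b \<or> ?P4 a b))"
      by (rule card_coprime_pairs_disj) arith
    moreover have "card (?Q (\<lambda>a b. ?P2 a b \<or> ?P3 a b \<or> ?P4 a b)) =
        card (?Q ?P2) + card (?Q (\<lambda>a b. ?P3 a b \<or> ?P4 a b))"
      by (rule card_coprime_pairs_disj) arith
    moreover have "card (?Q (\<lambda>a b. ?P3 a b \<or> ?P4 a b)) = card (?Q ?P3) + card (?Q ?P4)"
      by (rule card_coprime_pairs_disj) arith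
    ultimately show ?thesis by linarith
  qed
  have 1: "card (?Q ?P1) = totient m" by (rule card_coprime_pairs_quadrant)
  have 2: "card (?Q ?P2) = totient m"
    using card_coprime_pairs_quarter_turn[of m ?P1] 1 by (rule trans[OF sym])
  have 3: "card (?Q ?P3) = totient m"
    using card_coprime_pairs_quarter_turn[of m ?P2] 2 by (rule trans[OF sym])
  have 4: "card (?Q ?P4) = totient m"
    using card_coprime_pairs_quarter_turn[of m ?P3] 3 by (rule trans[OF sym])
  show ?thesis unfolding all sum 1 2 3 4 by simp
qed

theorem card_cyclically_reduced_primitives:
  assumes "m \<ge> 1"
  shows "card {w \<in> carrier (F 2). primitive (F 2) w \<and> cyclically_reduced w \<and> length w = m}
    = 4 * m * totient m"
proof -
  let ?Z = "coprime_pairs m (\<lambda>_ _. True)"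
  have "{w \<in> carrier (F 2). primitive (F 2) w \<and> cyclically_reduced w \<and> length w = m}
      = (\<Union>z \<in> ?Z. cyclic_primitives z)"
    using primitive_in_carrier[of "F 2"] length_cyclically_reduced_primitive primitive_coprime_expo
    by (fastforce simp: cyclic_primitives_def coprime_pairs_def)
  moreover have "card (\<Union>z \<in> ?Z. cyclic_primitives z) = (\<Sum>z \<in> ?Z. card (cyclic_primitives z))"
  proof (rule card_UN_disjoint[OF finite_coprime_pairs])
    have "card (cyclic_primitives z) = m" if "z \<in> ?Z" for z
      using that card_cyclic_primitives by (auto simp: coprime_pairs_def)
    then show "\<forall>z \<in> ?Z. finite (cyclic_primitives z)" using assms by (metis card_ge_0_finite less_le_trans zero_less_one)
    show "\<forall>z \<in> ?Z. \<forall>z' \<in> ?Z. z \<noteq> z' \<longrightarrow> cyclic_primitives z \<inter> cyclic_primitives z' = {}"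
      by (auto simp: cyclic_primitives_def)
  qed
  moreover have "(\<Sum>z \<in> ?Z. card (cyclic_primitives z)) = (\<Sum>z \<in> ?Z. m)"
    using card_cyclic_primitives by (intro sum.cong) (auto simp: coprime_pairs_def)
  ultimately show ?thesis using card_coprime_pairs[OF assms] by simp
qed

section \<open>Conjugates of short primitive words\<close>

abbreviation letters :: "(nat \<times> bool) set" where
  "letters \<equiv> {0, 1} \<times> UNIV"

text \<open>
  The letters \<open>t\<close> for which \<open>t w t\<^sup>-\<^sup>1\<close> needs no reduction.
\<close>

definition conjugators :: "nat word \<Rightarrow> (nat \<times> bool) set" where
  "conjugators w = letters - {inv_letter (hd w), last w}"

definition conjugates :: "nat word set \<Rightarrow> nat word set" where
  "conjugates Q = (\<lambda>(w, t). t # w @ [inv_letter t]) ` (SIGMA w:Q. conjugators w)"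

lemma card_conjugates:
  assumes "finite Q" "\<And>w. w \<in> Q \<Longrightarrow> card (conjugators w) = k"
  shows "card (conjugates Q) = k * card Q"
proof -
  have "inj_on (\<lambda>(w, t). t # w @ [inv_letter t]) (SIGMA w:Q. conjugators w)"
    by (auto simp: inj_on_def)
  then have "card (conjugates Q) = card (SIGMA w:Q. conjugators w)"
    unfolding conjugates_def by (rule card_image)
  also have "\<dots> = (\<Sum>w \<in> Q. card (conjugators w))"
    by (rule card_SigmaI) (use assms(1) in \<open>auto simp: conjugators_def\<close>)
  also have "\<dots> = k * card Q" using assms(2) by simp
  finally show ?thesis .
qed

lemma card_letters: "card letters = 4"
  by (simp add: card_cartesian_product)

lemma card_conjugators_cyclically_reduced:
  assumes "cyclically_reduced w" "w \<noteq> []" "set w \<subseteq> letters"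
  shows "card (conjugators w) = 2"
proof -
  have "inv_letter (hd w) \<noteq> last w"
    using assms by (metis cyclically_reduced_def inv_letter_inv_letter)
  moreover have "hd w \<in> letters" "last w \<in> letters"
    using assms(2,3) hd_in_set last_in_set by blast+
  then have "{inv_letter (hd w), last w} \<subseteq> letters"
    by (cases "hd w") auto
  ultimately show ?thesis
    unfolding conjugators_def by (subst card_Diff_subset) (simp_all add: card_letters)
qed

text \<open>
  The form that words take after conjugation by a letter: the two letters that a conjugator must
  avoid then coincide, which leaves three choices instead of two.
\<close>

definition conjugated :: "nat word \<Rightarrow> bool" where
  "conjugated w \<longleftrightarrow> w \<noteq> [] \<and> hd w \<in> letters \<and> hd w = inv_letter (last w)"

lemma card_conjugators_conjugated:
  assumes "conjugated w"
  shows "card (conjugators w) = 3"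
proof -
  have "{inv_letter (hd w), last w} = {last w}" "last w \<in> letters"
    using assms by (cases "last w"; auto simp: conjugated_def)+
  then show ?thesis
    unfolding conjugators_def by (simp add: card_Diff_subset card_letters)
qed

lemma conjugates_conjugated: "w \<in> conjugates Q \<Longrightarrow> conjugated w"
  by (auto simp: conjugates_def conjugators_def conjugated_def)

definition primitives :: "nat \<Rightarrow> nat \<Rightarrow> nat word set" where
  "primitives n m = {w \<in> carrier (F n). primitive (F n) w \<and> length w = m}"

lemma finite_primitives: "finite (primitives n m)"
proof (rule finite_subset)
  show "primitives n m \<subseteq> {w. set w \<subseteq> {..<n} \<times> UNIV \<and> length w = m}"
    by (auto simp: primitives_def F_def reduced_words_iff)
  show "finite {w :: nat word. set w \<subseteq> {..<n} \<times> UNIV \<and> length w = m}"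
    by (rule finite_lists_length_eq) simp
qed

lemma conjugates_primitives:
  assumes "n \<ge> 2" "[] \<notin> Q" "Q \<subseteq> primitives n m"
  shows "conjugates Q \<subseteq> primitives n (m + 2)"
proof
  fix v assume "v \<in> conjugates Q"
  then obtain w t where w: "w \<in> Q" and t: "t \<in> letters" "t \<noteq> inv_letter (hd w)" "t \<noteq> last w"
    and v: "v = t # w @ [inv_letter t]"
    by (auto simp: conjugates_def conjugators_def)
  have p: "primitive (F n) w" "length w = m" "w \<in> reduced_words {..<n}" "w \<noteq> []"
    using w assms(2,3) by (auto simp: primitives_def F_def)
  have t': "[t] \<in> reduced_words {..<n}" using t(1) assms(1) by (auto simp: letter_in_reduced_words)
  have "hd w \<noteq> inv_letter t" using t(2) by auto
  then have red: "reduced v"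
    using p(3,4) t v by (auto simp: reduced_Cons reduced_append reduced_words_iff)
  then have "v \<in> reduced_words {..<n}"
    using p(3) t' v by (auto simp: reduced_words_iff)
  moreover have "primitive (F n) v"
    using primitive_conjugate[of "{..<n}" w "[t]"] p(1) t' red v by (simp add: F_def reduce_reduced)
  ultimately show "v \<in> primitives n (m + 2)" using p(2) v by (simp add: primitives_def F_def)
qed

lemma card_iterated_conjugates:
  assumes "n \<ge> 2" "m > 0" "Q \<subseteq> primitives n m" "\<And>w. w \<in> Q \<Longrightarrow> cyclically_reduced w \<and> set w \<subseteq> letters"
  shows "\<exists>R \<subseteq> primitives n (m + 2 * Suc j). Ball R conjugated \<and> card R = 2 * 3 ^ j * card Q"
proof (induction j)
  case 0
  have ne: "[] \<notin> Q" using assms(2,3) by (auto simp: primitives_def)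
  have "finite Q" using assms(3) finite_primitives by (rule finite_subset)
  then have "card (conjugates Q) = 2 * card Q"
    using card_conjugators_cyclically_reduced assms(4) ne by (intro card_conjugates) metis+
  then show ?case
    using conjugates_primitives[OF assms(1) ne assms(3)] conjugates_conjugated
    by (intro exI[of _ "conjugates Q"]) auto
next
  case (Suc j)
  then obtain R where R: "R \<subseteq> primitives n (m + 2 * Suc j)" "Ball R conjugated" "card R = 2 * 3 ^ j * card Q"
    by blast
  have ne: "[] \<notin> R" using R(2) by (auto simp: conjugated_def)
  have "finite R" using R(1) finite_primitives by (rule finite_subset)
  then have "card (conjugates R) = 3 * card R"
    using card_conjugators_conjugated R(2) by (intro card_conjugates) auto
  moreover have "conjugates R \<subseteq> primitives n (m + 2 * Suc (Suc j))"
    using conjugates_primitives[OF assms(1) ne R(1)] by simp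
  ultimately show ?case
    using conjugates_conjugated R(3) by (intro exI[of _ "conjugates R"]) auto
qed

lemma primitive_two_letters:
  assumes "i < n" "j < n" "i \<noteq> j"
  shows "primitive (F n) [(i, b), (j, c)]"
proof -
  let ?G = "free_group {..<n}"
  have "lift ?G (transvection_map i j c) [(i, False)] = [(i, False), (j, c)]"
    using assms by (simp add: lift_Cons transvection_map_def reduce_def)
  then have pos: "primitive ?G [(i, False), (j, c)]"
    using iso_primitive[OF group_free_group group_free_group transvection_iso[of i "{..<n}" j c]
        primitive_letter[of i n False, unfolded F_def]] assms by simp
  have "lift ?G (flip_map i) [(i, False), (j, c)] = [(i, True), (j, c)]"
    using assms
    by (cases c) (auto simp: lift_Cons flip_map_def reduce_def inv_free_group letter_in_reduced_words)
  then have "primitive ?G [(i, True), (j, c)]"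
    using iso_primitive[OF group_free_group group_free_group flip_iso[of i "{..<n}"] pos] assms by simp
  then show ?thesis using pos by (cases b) (auto simp: F_def)
qed

text \<open>
  The transvection \<open>y \<mapsto> y x\<close> adds one \<open>x\<close> at a time.
\<close>

lemma primitive_Cons_replicate:
  assumes "n \<ge> 2"
  shows "primitive (F n) ((1, False) # replicate k (0, False))"
proof (induction k)
  case 0
  then show ?case using primitive_letter[of 1 n False] assms by simp
next
  case (Suc k)
  let ?G = "free_group {..<n}" and ?f = "transvection_map 1 0 False :: nat \<Rightarrow> nat word"
  have red: "reduce ((1 :: nat, False) # replicate k (0, False)) = (1, False) # replicate k (0, False)" for k
    by (rule reduce_reduced[OF positive_reduced[of False False]]) (auto simp: positive_def)
  have red': "reduce (replicate k (0 :: nat, False)) = replicate k (0, False)" for k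
    by (rule reduce_reduced[OF positive_reduced[of False False]]) (auto simp: positive_def)
  have "lift ?G ?f (replicate k (0, False)) = replicate k (0, False)" for k
  proof (induction k)
    case (Suc k)
    then show ?case using red'[of "Suc k"] by (simp add: lift_Cons transvection_map_def)
  qed simp
  then have "lift ?G ?f ((1, False) # replicate k (0, False)) = (1, False) # replicate (Suc k) (0, False)"
    using red[of "Suc k"] by (simp add: lift_Cons transvection_map_def)
  then show ?case
    using iso_primitive[OF group_free_group group_free_group transvection_iso[of 1 "{..<n}" 0 False]
        Suc[unfolded F_def]] assms by (simp add: F_def)
qed

text \<open>
  The conjugates of letters alone attain the bound; strictness comes from \<open>y x\<^sup>2\<^sup>j\<^sup>+\<^sup>2\<close>, which is
  cyclically reduced and hence not among them.
\<close>

lemma card_primitives_odd: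
  assumes "n \<ge> 2"
  shows "card (primitives n 1) \<ge> 4" "card (primitives n (2 * j + 3)) > 8 * 3 ^ j"
proof -
  let ?Q = "(\<lambda>l. [l]) ` letters"
  have Q: "?Q \<subseteq> primitives n 1"
    using primitive_letter assms by (auto simp: primitives_def F_def letter_in_reduced_words)
  have card: "card ?Q = 4" by (subst card_image) (auto simp: card_letters inj_on_def)
  then show "card (primitives n 1) \<ge> 4" using card_mono[OF finite_primitives Q] by simp
  have short: "cyclically_reduced w \<and> set w \<subseteq> letters" if "w \<in> ?Q" for w
    using that by (auto simp: cyclically_reduced_def reduced_Cons)
  obtain R where R: "R \<subseteq> primitives n (1 + 2 * Suc j)" "Ball R conjugated" "card R = 2 * 3 ^ j * card ?Q"
    using card_iterated_conjugates[OF assms _ Q short, of j] by auto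
  let ?w = "(1, False) # replicate (2 * j + 2) (0, False) :: nat word"
  have "reduced ?w" by (rule positive_reduced[of False False]) (auto simp: positive_def)
  then have "?w \<in> primitives n (1 + 2 * Suc j)"
    using primitive_Cons_replicate[OF assms, of "2 * j + 2"] assms
    by (auto simp: primitives_def F_def reduced_words_iff)
  moreover have "?w \<notin> R"
  proof
    assume "?w \<in> R"
    then have "hd ?w = inv_letter (last ?w)" using R(2) unfolding conjugated_def by blast
    moreover have "last ((1 :: nat, False) # replicate (Suc k) (0, False)) = (0, False)" for k
      by (induction k) auto
    from this[of "2 * j + 1"] have "last ?w = (0, False)" by simp
    ultimately show False by simp
  qed
  ultimately have "card R < card (primitives n (1 + 2 * Suc j))"
    using R(1) by (intro psubset_card_mono finite_primitives) auto
  then show "card (primitives n (2 * j + 3)) > 8 * 3 ^ j"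
    using R(3) card by (simp add: numeral_3_eq_3)
qed

lemma card_primitives_even:
  assumes "n \<ge> 2"
  shows "card (primitives n 2) \<ge> 8" "card (primitives n (2 * j + 4)) \<ge> 16 * 3 ^ j"
proof -
  let ?Q = "(\<lambda>(i, b, c). [(i, b), (1 - i, c)]) ` ({0, 1 :: nat} \<times> (UNIV :: bool set) \<times> (UNIV :: bool set))"
  have Q: "?Q \<subseteq> primitives n 2"
    using primitive_two_letters[of _ n] assms
    by (auto simp: primitives_def F_def reduced_words_Cons)
  have card: "card ?Q = 8"
    by (subst card_image) (auto simp: inj_on_def card_cartesian_product simp del: UNIV_Times_UNIV)
  then show "card (primitives n 2) \<ge> 8" using card_mono[OF finite_primitives Q] by simp
  have short: "cyclically_reduced w \<and> set w \<subseteq> letters" if "w \<in> ?Q" for w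
    using that by (auto simp: cyclically_reduced_def reduced_Cons)
  obtain R where R: "R \<subseteq> primitives n (2 + 2 * Suc j)" "card R = 2 * 3 ^ j * card ?Q"
    using card_iterated_conjugates[OF assms _ Q short, of j] by auto
  have eq: "2 + 2 * Suc j = 2 * j + 4" by simp
  then show "card (primitives n (2 * j + 4)) \<ge> 16 * 3 ^ j"
    using card_mono[OF finite_primitives R(1)] unfolding eq R(2) card by simp
qed

theorem proposition1p4:
  fixes m :: nat
  assumes "m \<ge> 1"
  shows
    "(odd m \<longrightarrow>
        (\<forall>n \<ge> 2. real (card {w \<in> carrier (F n). primitive (F n) w \<and> length w = m})
                 > 8 / (3 * sqrt 3) * sqrt 3 ^ m)) \<and>
     (even m \<longrightarrow>
        (\<forall>n \<ge> 2. real (card {w \<in> carrier (F n). primitive (F n) w \<and> length w = m})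
                 > 4 / 3 * sqrt 3 ^ m)) \<and>
     card {w \<in> carrier (F 2). primitive (F 2) w \<and> cyclically_reduced w \<and> length w = m}
       = 4 * m * totient m"
proof (intro conjI impI allI)
  fix n :: nat assume "odd m" "n \<ge> 2"
  show "real (card {w \<in> carrier (F n). primitive (F n) w \<and> length w = m}) > 8 / (3 * sqrt 3) * sqrt 3 ^ m"
    unfolding primitives_def[symmetric]
  proof (cases "m = 1")
    case True
    then show "real (card (primitives n m)) > 8 / (3 * sqrt 3) * sqrt 3 ^ m"
      using card_primitives_odd(1)[OF \<open>n \<ge> 2\<close>] by simp
  next
    case False
    obtain k where "m = 2 * k + 1" using \<open>odd m\<close> by (rule oddE)
    moreover define j where "j = k - 1"
    ultimately have m: "m = 2 * j + 3" using False by simp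
    have "sqrt 3 ^ m = 3 * sqrt 3 * 3 ^ j"
      by (simp add: m power_add power_mult power3_eq_cube)
    then have "8 / (3 * sqrt 3) * sqrt 3 ^ m = real (8 * 3 ^ j)" by simp
    also have "\<dots> < real (card (primitives n m))"
      unfolding m of_nat_less_iff by (rule card_primitives_odd(2)[OF \<open>n \<ge> 2\<close>])
    finally show "real (card (primitives n m)) > 8 / (3 * sqrt 3) * sqrt 3 ^ m" .
  qed
next
  fix n :: nat assume "even m" "n \<ge> 2"
  show "real (card {w \<in> carrier (F n). primitive (F n) w \<and> length w = m}) > 4 / 3 * sqrt 3 ^ m"
    unfolding primitives_def[symmetric]
  proof (cases "m = 2")
    case True
    then show "real (card (primitives n m)) > 4 / 3 * sqrt 3 ^ m"
      using card_primitives_even(1)[OF \<open>n \<ge> 2\<close>] by simp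
  next
    case False
    obtain k where "m = 2 * k" using \<open>even m\<close> by blast
    moreover define j where "j = k - 2"
    ultimately have m: "m = 2 * j + 4" using False assms by simp
    have "sqrt 3 ^ m = 9 * 3 ^ j"
      by (simp add: m power_add power_mult power4_eq_xxxx)
    then have "4 / 3 * sqrt 3 ^ m < real (16 * 3 ^ j)" by simp
    also have "\<dots> \<le> real (card (primitives n m))"
      unfolding m of_nat_le_iff by (rule card_primitives_even(2)[OF \<open>n \<ge> 2\<close>])
    finally show "real (card (primitives n m)) > 4 / 3 * sqrt 3 ^ m" .
  qed
qed (rule card_cyclically_reduced_primitives[OF assms])

end
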